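(* Let $h_1,h_2,h_3\in\mathbb R$ with $h_1^2\geq h_2^2\geq h_3^2$ and $P>0$. The sum-capacity $C_N$ of the (non-restricted) Gaussian Y-channel with gains $h_1,h_2,h_3$ and power $P$ satisfies $C_N\geq\underline{C}_1$, where $$\underline{C}_1=\min\Big\{\tfrac12\big[C(\min\{h_1^2,h_2^2+h_3^2\}P)+C(h_2^2P)+C(h_3^2P)\big],\ C((h_1^2+h_2^2+h_3^2)P),\ 2C(h_3^2P)\Big\}.$$
   Context: $C(x)=\frac12\log_2(1+x)$. The (non-restricted, reciprocal) Gaussian Y-channel with real gains $h_1,h_2,h_3$ and power $P>0$: users $1,2,3$ and a relay $r$. For each ordered pair $(j,k)$ of distinct indices in $\{1,2,3\}$, user $j$ holds a message $m_{jk}$, uniform on $\{1,\dots,2^{nR_{jk}}\}$, intended for user $k$; the six messages are mutually independent. Over channel uses $i=1,\dots,n$, the relay receives $Y_{ri}=h_1X_{1i}+h_2X_{2i}+h_3X_{3i}+Z_{ri}$ and user $j$ receives $Y_{ji}=h_jX_{ri}+Z_{ji}$, all noise samples i.i.d. $\mathcal N(0,1)$ independent of the messages. Encoders $X_{ji}=f_{ji}(m_{jk},m_{jl},Y_j^{i-1})$ ($\{k,l\}=\{1,2,3\}\setminus\{j\}$), relay $X_{ri}=f_{ri}(Y_r^{i-1})$, power constraints $\frac1n\sum_i\mathbb E[X_{ai}^2]\le P$ for $a\in\{1,2,3,r\}$; user $j$ estimates $(m_{kj},m_{lj})$ from $(Y_j^n,m_{jk},m_{jl})$. A rate tuple is achievable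 if codes exist whose error probability tends to $0$ as $n\to\infty$; $C_N$ is the supremum of $\sum_{j\ne k}R_{jk}$ over achievable tuples. *)

theory Defs
  imports "HOL-Probability.Probability"
begin

definition Cf :: "real \<Rightarrow> real" where
  "Cf x = 1/2 * log 2 (1 + x)"

text \<open>Users are 1, 2, 3; the relay is node 0. For user j, its two partners
  (in increasing order) are oth1 j and oth2 j.\<close>
definition oth1 :: "nat \<Rightarrow> nat" where
  "oth1 j = (if j = 1 then 2 else 1)"
definition oth2 :: "nat \<Rightarrow> nat" where
  "oth2 j = (if j = 3 then 2 else 3)"

definition user_pairs :: "(nat \<times> nat) set" where
  "user_pairs = {(j, k). j \<in> {1,2,3} \<and> k \<in> {1,2,3} \<and> j \<noteq> k}"

text \<open>A code of block length n.
  enc j i a b y : transmit symbol of user j at time i (i < n), given its own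
     messages a = m_{j,oth1 j}, b = m_{j,oth2 j} and past outputs y = Y_j^{i-1}
     (as an extensional function on {..<i}).
  rel i y : relay symbol at time i given past relay outputs y = Y_r^{i-1}.
  dec j a b y : estimate (m_{oth1 j, j}, m_{oth2 j, j}) from own messages a, b
     and the whole received block y = Y_j^n (extensional on {..<n}).\<close>
record ycode =
  enc :: "nat \<Rightarrow> nat \<Rightarrow> nat \<Rightarrow> nat \<Rightarrow> (nat \<Rightarrow> real) \<Rightarrow> real"
  rel :: "nat \<Rightarrow> (nat \<Rightarrow> real) \<Rightarrow> real"
  dec :: "nat \<Rightarrow> nat \<Rightarrow> nat \<Rightarrow> (nat \<Rightarrow> real) \<Rightarrow> nat \<times> nat"

definition gain :: "real \<Rightarrow> real \<Rightarrow> real \<Rightarrow> nat \<Rightarrow> real" where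
  "gain h1 h2 h3 j = (if j = 1 then h1 else if j = 2 then h2 else h3)"

text \<open>Transmitted symbol of node a (0 = relay) at time i, given the table Yp of
  received signals (Yp a t = output at node a at time t, valid for t < i).\<close>
definition xsym :: "ycode \<Rightarrow> (nat \<Rightarrow> nat \<Rightarrow> nat) \<Rightarrow> (nat \<Rightarrow> nat \<Rightarrow> real) \<Rightarrow> nat \<Rightarrow> nat \<Rightarrow> real" where
  "xsym c m Yp i a =
     (if a = 0 then rel c i (restrict (Yp 0) {..<i})
      else enc c a i (m a (oth1 a)) (m a (oth2 a)) (restrict (Yp a) {..<i}))"

text \<open>Received signals up to (excluding) time i, for messages m and noise
  realization z (z (a, t) = noise at node a at time t).\<close>
primrec ypast :: "real \<Rightarrow> real \<Rightarrow> real \<Rightarrow> ycode \<Rightarrow> (nat \<Rightarrow> nat \<Rightarrow> nat) \<Rightarrow> (nat \<times> nat \<Rightarrow> real)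
    \<Rightarrow> nat \<Rightarrow> (nat \<Rightarrow> nat \<Rightarrow> real)" where
  "ypast h1 h2 h3 c m z 0 = (\<lambda>a t. 0)"
| "ypast h1 h2 h3 c m z (Suc i) =
     (let Yp = ypast h1 h2 h3 c m z i;
          X = xsym c m Yp i
      in (\<lambda>a t. if t = i then
                   (if a = 0 then h1 * X 1 + h2 * X 2 + h3 * X 3 + z (0, i)
                    else gain h1 h2 h3 a * X 0 + z (a, i))
                 else Yp a t))"

definition msize :: "nat \<Rightarrow> real \<Rightarrow> nat" where
  "msize n r = nat \<lceil>2 powr (real n * r)\<rceil>"

definition msgs :: "nat \<Rightarrow> (nat \<Rightarrow> nat \<Rightarrow> real) \<Rightarrow> (nat \<Rightarrow> nat \<Rightarrow> nat) set" where
  "msgs n R = {m. \<forall>j k. if (j, k) \<in> user_pairs then m j k \<in> {1..msize n (R j k)} else m j k = 0}"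

definition noise :: "nat \<Rightarrow> (nat \<times> nat \<Rightarrow> real) measure" where
  "noise n = PiM ({..<4} \<times> {..<n}) (\<lambda>_. density lborel (\<lambda>x. ennreal (std_normal_density x)))"

definition code_measurable :: "nat \<Rightarrow> ycode \<Rightarrow> bool" where
  "code_measurable n c \<longleftrightarrow>
     (\<forall>j a b i. enc c j i a b \<in> borel_measurable (PiM {..<i} (\<lambda>_. borel))) \<and>
     (\<forall>i. rel c i \<in> borel_measurable (PiM {..<i} (\<lambda>_. borel))) \<and>
     (\<forall>j a b. dec c j a b \<in> measurable (PiM {..<n} (\<lambda>_. borel)) (count_space UNIV))"

definition power_ok :: "real \<Rightarrow> real \<Rightarrow> real \<Rightarrow> real \<Rightarrow> nat \<Rightarrow> (nat \<Rightarrow> nat \<Rightarrow> real) \<Rightarrow> ycode \<Rightarrow> bool" where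
  "power_ok h1 h2 h3 P n R c \<longleftrightarrow>
     (\<forall>a\<in>{0,1,2,3}.
        (\<Sum>i<n. (\<Sum>m\<in>msgs n R. \<integral>\<^sup>+ z. ennreal ((xsym c m (ypast h1 h2 h3 c m z i) i a)\<^sup>2) \<partial>noise n)
                  / ennreal (real (card (msgs n R)))) / ennreal (real n) \<le> ennreal P)"

definition err_event :: "real \<Rightarrow> real \<Rightarrow> real \<Rightarrow> nat \<Rightarrow> ycode \<Rightarrow> (nat \<Rightarrow> nat \<Rightarrow> nat) \<Rightarrow> (nat \<times> nat \<Rightarrow> real) set" where
  "err_event h1 h2 h3 n c m =
     {z \<in> space (noise n). \<exists>j\<in>{1,2,3}.
        dec c j (m j (oth1 j)) (m j (oth2 j)) (restrict (ypast h1 h2 h3 c m z n j) {..<n})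
          \<noteq> (m (oth1 j) j, m (oth2 j) j)}"

definition perr :: "real \<Rightarrow> real \<Rightarrow> real \<Rightarrow> nat \<Rightarrow> (nat \<Rightarrow> nat \<Rightarrow> real) \<Rightarrow> ycode \<Rightarrow> real" where
  "perr h1 h2 h3 n R c =
     (\<Sum>m\<in>msgs n R. measure (noise n) (err_event h1 h2 h3 n c m)) / real (card (msgs n R))"

definition achievable :: "real \<Rightarrow> real \<Rightarrow> real \<Rightarrow> real \<Rightarrow> (nat \<Rightarrow> nat \<Rightarrow> real) \<Rightarrow> bool" where
  "achievable h1 h2 h3 P R \<longleftrightarrow>
     (\<forall>(j, k)\<in>user_pairs. 0 \<le> R j k) \<and>
     (\<exists>c :: nat \<Rightarrow> ycode.
        (\<forall>n. code_measurable n (c n) \<and> power_ok h1 h2 h3 P n R (c n)) \<and>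
        (\<lambda>n. perr h1 h2 h3 n R (c n)) \<longlonglongrightarrow> 0)"

definition sum_capacity :: "real \<Rightarrow> real \<Rightarrow> real \<Rightarrow> real \<Rightarrow> ereal" where
  "sum_capacity h1 h2 h3 P =
     (SUP R \<in> {R. achievable h1 h2 h3 P R}. ereal (\<Sum>(j, k)\<in>user_pairs. R j k))"

end

theory Submission
  imports Defs
begin

text \<open>
  Complete decode-and-forward with block Markov coding. In each block the relay decodes the codewords
  of all three users as in a Gaussian multiple access channel, and in the next block it broadcasts one codeword
  indexed by the triple of decoded messages; a user removes the uncertainty about its own message. Writing \<open>r1\<close>, \<open>r2\<close>, \<open>r3\<close> for
  the total rates of the users, this needs that the sum of rates over every set of users stays below the
  capacity of their total received power, that \<open>r2 + r3\<close> stays below \<open>Cf (h1\<^sup>2 * P)\<close>, and that \<open>r1 + r3\<close> stays below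
  \<open>Cf (h2\<^sup>2 * P)\<close>; rates summing to the claimed bound satisfy these constraints.

  The error analysis uses i.i.d. Gaussian codebooks. The true codewords pass the decoding tests by
  Chebyshev's inequality, and a wrong codeword passes with exponentially small probability, because the
  likelihood ratio has mean one under independence. For every message the error probability
  averaged over codebooks is small, so some codebook has small average error.
\<close>

section \<open>Independent Gaussian variables\<close>

text \<open>The bound is the optimum of a small linear program. With the names of
  \<open>theorem3\<close>, its constraints are \<open>r1 + r2 \<le> C3\<close> (what user 3 could
  decode from the relay), \<open>r1 + r3 \<le> C2\<close> (user 2), \<open>r2 + r3 \<le> C23\<close>
  (user 1, and users 2 and 3 together on the uplink), \<open>r3 \<le> C3\<close>, and a total of at
  most \<open>Cs\<close>. Adding the first three gives the half sum, adding the first and the fourth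
  gives \<open>2 * C3\<close>; conversely \<open>theorem3\<close> picks rates that attain the
  minimum. What the relay sends depends on past noise through its decisions, which spoils
  independence. The error events are therefore stated for ideal outputs, in which every node sends
  the codeword of the true digits: each event involves only independent normal coordinates, and if
  none occurs the real transmission is the ideal one. So a union bound over the blocks suffices, and
  all blocks can share one codebook. Strict inequalities are bought by a power below
  \<open>P\<close>, digit rates below capacity, and many blocks to dilute the one block of delay;
  all of these are chosen for a fixed loss factor \<open>1 - \<eta>\<close>, and
  \<open>\<eta>\<close> tends to 0 only at the very end.\<close>

lemma (in prob_space) indep_vars_pair:
  assumes ind: "indep_vars (\<lambda>_. borel) X I" and ij: "i \<in> I" "j \<in> I" "i \<noteq> j"
  shows "indep_var borel (X i) borel (X j)"
proof -
  have "indep_var borel ((\<lambda>f. f i) \<circ> (\<lambda>\<omega>. restrict (\<lambda>i. X i \<omega>) {i}))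
      borel ((\<lambda>f. f j) \<circ> (\<lambda>\<omega>. restrict (\<lambda>i. X i \<omega>) {j}))"
    using ij by (intro indep_var_compose[OF indep_var_restrict[OF ind]]) auto
  then show ?thesis
    by (simp add: comp_def)
qed

text \<open>The centred squares are pairwise uncorrelated and have variance 3 - 1 = 2, where 3 is
  the fourth moment of a standard normal; this is Chebyshev's inequality for their sum. A decay like
  1/N is enough, since it is applied to a number of events that does not grow with N.\<close>

lemma (in prob_space) indep_std_normal_sum_squares_deviation:
  fixes A :: "'i \<Rightarrow> 'a \<Rightarrow> real"
  assumes fin: "finite T" and ne: "T \<noteq> {}"
    and ind: "indep_vars (\<lambda>_. borel) A T"
    and normal: "\<And>i. i \<in> T \<Longrightarrow> distributed M lborel (A i) (\<lambda>x. ennreal (std_normal_density x))"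
    and e: "0 < e"
  shows "prob {x \<in> space M. \<bar>(\<Sum>i\<in>T. (A i x)\<^sup>2) - real (card T)\<bar> \<ge> e * real (card T)}
     \<le> 2 / (e\<^sup>2 * real (card T))"
proof -
  define U where "U i x = (A i x)\<^sup>2 - 1" for i x
  have rvA: "random_variable borel (A i)" if "i \<in> T" for i
    using ind that by (auto simp: indep_vars_def)
  have int2: "integrable M (\<lambda>x. (A i x)^2)" and int4: "integrable M (\<lambda>x. (A i x)^4)"
    and ex2: "expectation (\<lambda>x. (A i x)^2) = 1" and ex4: "expectation (\<lambda>x. (A i x)^4) = 3" if "i \<in> T" for i
    using distributed_integrable[OF normal[OF that], of "\<lambda>x. x^2"]
      distributed_integrable[OF normal[OF that], of "\<lambda>x. x^4"]
      distributed_integral[OF normal[OF that], of "\<lambda>x. x^2"]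
      distributed_integral[OF normal[OF that], of "\<lambda>x. x^4"]
      integral_std_normal_moment_even[of 1] integral_std_normal_moment_even[of 2]
      integrable_std_normal_moment[of 2] integrable_std_normal_moment[of 4]
    by (auto simp: fact_numeral)
  have indU: "indep_vars (\<lambda>_. borel) U T"
    using indep_vars_compose2[OF ind, of "\<lambda>_ x. x\<^sup>2 - 1" "\<lambda>_. borel"] by (simp add: U_def[abs_def])
  have intU: "integrable M (U i)" and exU: "expectation (U i) = 0" if "i \<in> T" for i
    using int2[OF that] ex2[OF that] by (auto simp: U_def[abs_def] prob_space)
  have sq: "(U i x)\<^sup>2 = (A i x)^4 - 2 * (A i x)^2 + 1" for i x
    by (simp add: U_def power2_eq_square algebra_simps power4_eq_xxxx)
  have intUU: "integrable M (\<lambda>x. U i x * U j x)" and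
    exUU: "expectation (\<lambda>x. U i x * U j x) = (if i = j then 2 else 0)" if "i \<in> T" "j \<in> T" for i j
  proof -
    show "integrable M (\<lambda>x. U i x * U j x)"
    proof (cases "i = j")
      case True
      then show ?thesis
        using int2[OF that(1)] int4[OF that(1)] by (simp add: power2_eq_square[symmetric] sq)
    next
      case False
      then show ?thesis
        by (intro indep_var_integrable indep_vars_pair[OF indU] intU that)
    qed
    show "expectation (\<lambda>x. U i x * U j x) = (if i = j then 2 else 0)"
    proof (cases "i = j")
      case True
      then show ?thesis
        using int2[OF that(1)] int4[OF that(1)] ex2[OF that(1)] ex4[OF that(1)]
        by (simp add: power2_eq_square[symmetric] sq prob_space)
    next
      case False
      then show ?thesis
        using exU that by (simp add: indep_var_lebesgue_integral indep_vars_pair[OF indU] intU)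
    qed
  qed
  define S where "S x = (\<Sum>i\<in>T. U i x)" for x
  have S2: "(S x)\<^sup>2 = (\<Sum>i\<in>T. \<Sum>j\<in>T. U i x * U j x)" for x
    by (simp add: S_def power2_eq_square sum_product)
  have rvS: "random_variable borel S"
    unfolding S_def[abs_def] U_def using rvA by measurable
  have exS: "expectation S = 0"
    unfolding S_def[abs_def] using intU exU by (subst Bochner_Integration.integral_sum) auto
  have intS2: "integrable M (\<lambda>x. (S x)\<^sup>2)"
    unfolding S2 using intUU by (intro Bochner_Integration.integrable_sum) auto
  have "expectation (\<lambda>x. (S x)\<^sup>2) = (\<Sum>i\<in>T. \<Sum>j\<in>T. expectation (\<lambda>x. U i x * U j x))"
    unfolding S2 using intUU
    by (simp add: Bochner_Integration.integral_sum Bochner_Integration.integrable_sum)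
  also have "\<dots> = 2 * real (card T)"
    using fin by (simp add: exUU)
  finally have exS2: "expectation (\<lambda>x. (S x)\<^sup>2) = 2 * real (card T)" .
  have c: "real (card T) > 0"
    using fin ne by (simp add: card_gt_0_iff)
  have "prob {x \<in> space M. \<bar>S x - expectation S\<bar> \<ge> e * real (card T)} \<le> variance S / (e * real (card T))\<^sup>2"
    by (rule Chebyshev_inequality[OF rvS intS2]) (use e c in simp)
  also have "\<dots> = 2 / (e\<^sup>2 * real (card T))"
  proof -
    have "variance S = 2 * real (card T)"
      by (simp add: exS exS2)
    then show ?thesis
      using c e by (simp add: power2_eq_square)
  qed
  finally show ?thesis
    by (simp add: exS S_def U_def sum_subtractf)
qed

text \<open>The likelihood ratio of the channel law against the output law has mean one when the codeword
  is independent of the output, so Markov's inequality bounds the chance that it is large.\<close>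

lemma (in prob_space) indep_normal_confusion:
  fixes V W :: "'i \<Rightarrow> 'a \<Rightarrow> real"
  assumes fin: "finite T"
    and ind: "indep_vars (\<lambda>_. borel) (\<lambda>(b, t). if b then W t else V t) (UNIV \<times> T)"
    and V: "\<And>t. t \<in> T \<Longrightarrow> distributed M lborel (V t) (\<lambda>x. ennreal (normal_density 0 (sqrt p) x))"
    and W: "\<And>t. t \<in> T \<Longrightarrow> distributed M lborel (W t) (\<lambda>x. ennreal (normal_density 0 (sqrt (1 + p)) x))"
    and p: "0 < p"
  shows "prob {x \<in> space M. (\<Sum>t\<in>T. (W t x - V t x)\<^sup>2) \<le> real (card T) * (1 + e) \<and>
      (\<Sum>t\<in>T. (W t x)\<^sup>2) \<ge> real (card T) * (1 + p) * (1 - e)}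
     \<le> (exp e / sqrt (1 + p)) ^ card T"
proof -
  define r where "r w v = std_normal_density (w - v) / normal_density 0 (sqrt (1 + p)) w" for w v
  have r0: "0 \<le> r w v" for w v
    by (simp add: r_def)
  have [measurable]: "V t \<in> borel_measurable M" "W t \<in> borel_measurable M" if "t \<in> T" for t
    using V[OF that] W[OF that] by (auto simp: distributed_def)
  have r_eq: "r w v = sqrt (1 + p) * exp (w\<^sup>2 / (2 * (1 + p)) - (w - v)\<^sup>2 / 2)" for w v
  proof -
    have "r w v = (1 / sqrt (2 * pi) * exp (- (w - v)\<^sup>2 / 2)) / (1 / (sqrt (2 * pi) * sqrt (1 + p)) * exp (- w\<^sup>2 / (2 * (1 + p))))"
      using p unfolding r_def std_normal_density_def normal_density_def by (simp add: real_sqrt_mult)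
    also have "\<dots> = sqrt (1 + p) * (exp (- (w - v)\<^sup>2 / 2) / exp (- w\<^sup>2 / (2 * (1 + p))))"
      using p by simp
    also have "\<dots> = sqrt (1 + p) * exp (w\<^sup>2 / (2 * (1 + p)) - (w - v)\<^sup>2 / 2)"
      by (simp add: exp_diff[symmetric])
    finally show ?thesis .
  qed
  have letter: "(\<integral>\<^sup>+x. ennreal (r (W t x) (V t x)) \<partial>M) = 1" if t: "t \<in> T" for t
  proof -
    have iv: "indep_var borel (W t) borel (V t)"
      using indep_vars_pair[OF ind, of "(True, t)" "(False, t)"] t by simp
    have iv': "indep_var lborel (W t) lborel (V t)"
      using iv by (simp add: indep_var_eq)
    note D = distributed_joint_indep[OF lborel.sigma_finite_measure_axioms lborel.sigma_finite_measure_axioms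
        W[OF t] V[OF t] iv']
    have "(\<integral>\<^sup>+x. ennreal (r (W t x) (V t x)) \<partial>M) =
       (\<integral>\<^sup>+z. (case z of (w, v) \<Rightarrow> ennreal (normal_density 0 (sqrt (1 + p)) w) * ennreal (normal_density 0 (sqrt p) v))
          * ennreal (r (fst z) (snd z)) \<partial>(lborel \<Otimes>\<^sub>M lborel))"
      by (subst distributed_nn_integral[OF D]) (auto simp: r_def)
    \<comment> \<open>The density of the output cancels the denominator of \<open>r\<close>. What
      remains is the joint density of a codeword letter and the output it would cause, whose total
      mass is 1.\<close>
    also have "\<dots> = (\<integral>\<^sup>+z. ennreal (normal_density 0 (sqrt p) (snd z)) * ennreal (std_normal_density (fst z - snd z))
         \<partial>(lborel \<Otimes>\<^sub>M lborel))"
    proof (intro nn_integral_cong, clarify)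
      fix w v :: real
      have "normal_density 0 (sqrt (1 + p)) w > 0"
        using p by (simp add: normal_density_pos)
      then show "ennreal (normal_density 0 (sqrt (1 + p)) w) * ennreal (normal_density 0 (sqrt p) v) * ennreal (r (fst (w, v)) (snd (w, v)))
         = ennreal (normal_density 0 (sqrt p) (snd (w, v))) * ennreal (std_normal_density (fst (w, v) - snd (w, v)))"
        by (simp add: r_def ennreal_mult'[symmetric] field_simps)
    qed
    also have "\<dots> = (\<integral>\<^sup>+v. \<integral>\<^sup>+w. ennreal (normal_density 0 (sqrt p) v) * ennreal (std_normal_density (w - v)) \<partial>lborel \<partial>lborel)"
      by (subst lborel_pair.nn_integral_snd[symmetric]) auto
    also have "\<dots> = (\<integral>\<^sup>+v. ennreal (normal_density 0 (sqrt p) v) \<partial>lborel)"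
    proof (rule nn_integral_cong)
      fix v :: real
      have "(\<integral>\<^sup>+w. ennreal (std_normal_density (w - v)) \<partial>lborel) = (\<integral>\<^sup>+w. ennreal (std_normal_density w) \<partial>lborel)"
        by (subst nn_integral_real_affine[where c=1 and t="v"]) auto
      also have "\<dots> = 1"
        by (simp add: nn_integral_eq_integral)
      finally show "(\<integral>\<^sup>+w. ennreal (normal_density 0 (sqrt p) v) * ennreal (std_normal_density (w - v)) \<partial>lborel)
         = ennreal (normal_density 0 (sqrt p) v)"
        by (simp add: nn_integral_cmult)
    qed
    also have "\<dots> = 1"
      using p by (simp add: nn_integral_eq_integral)
    finally show ?thesis .
  qed
  have indr: "indep_vars (\<lambda>_. borel) (\<lambda>t x. r (W t x) (V t x)) T"
  proof -
    have "indep_vars (\<lambda>t. PiM (UNIV \<times> {t}) (\<lambda>_. borel))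
        (\<lambda>t x. restrict (\<lambda>i. (case i of (b, t) \<Rightarrow> if b then W t else V t) x) (UNIV \<times> {t})) T"
      by (rule indep_vars_restrict[OF ind]) (auto simp: disjoint_family_on_def)
    from indep_vars_compose2[OF this, of "\<lambda>t f. r (f (True, t)) (f (False, t))" "\<lambda>_. borel"]
    show ?thesis
      by (simp add: r_def)
  qed
  have total: "(\<integral>\<^sup>+x. ennreal (\<Prod>t\<in>T. r (W t x) (V t x)) \<partial>M) = 1"
  proof -
    have "indep_vars (\<lambda>_. borel) (\<lambda>t x. ennreal (r (W t x) (V t x))) T"
      using indep_vars_compose2[OF indr, of "\<lambda>_. ennreal" "\<lambda>_. borel"] by simp
    from indep_vars_nn_integral[OF fin this] show ?thesis
      by (simp add: letter prod_ennreal r0)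
  qed
  \<comment> \<open>\<open>g\<close> is the least value of the product of the likelihood ratios on
    the event: per letter the exponent is at least (1 - e)/2 - (1 + e)/2 = -e, the first term from
    the output energy and the second from the residual energy. Markov's inequality at level
    \<open>g\<close> gives the claim.\<close>
  define g where "g = (sqrt (1 + p) / exp e) ^ card T"
  have g0: "g > 0"
    using p by (simp add: g_def)
  let ?E = "{x \<in> space M. (\<Sum>t\<in>T. (W t x - V t x)\<^sup>2) \<le> real (card T) * (1 + e) \<and>
      (\<Sum>t\<in>T. (W t x)\<^sup>2) \<ge> real (card T) * (1 + p) * (1 - e)}"
  have sub: "?E \<subseteq> {x \<in> space M. 1 \<le> ennreal (1 / g) * ennreal (\<Prod>t\<in>T. r (W t x) (V t x))}"
  proof clarify
    fix x assume x: "x \<in> space M" and a: "(\<Sum>t\<in>T. (W t x - V t x)\<^sup>2) \<le> real (card T) * (1 + e)"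
      and b: "real (card T) * (1 + p) * (1 - e) \<le> (\<Sum>t\<in>T. (W t x)\<^sup>2)"
    have b': "real (card T) * (1 - e) \<le> (\<Sum>t\<in>T. (W t x)\<^sup>2) / (1 + p)"
      using b p by (simp add: field_simps)
    have "g = sqrt (1 + p) ^ card T * exp (- (real (card T) * e))"
      by (simp add: g_def power_divide exp_minus exp_of_nat2_mult field_simps)
    also have "\<dots> \<le> sqrt (1 + p) ^ card T * exp ((\<Sum>t\<in>T. (W t x)\<^sup>2) / (1 + p) / 2 - (\<Sum>t\<in>T. (W t x - V t x)\<^sup>2) / 2)"
    proof (intro mult_left_mono)
      show "exp (- (real (card T) * e)) \<le> exp ((\<Sum>t\<in>T. (W t x)\<^sup>2) / (1 + p) / 2 - (\<Sum>t\<in>T. (W t x - V t x)\<^sup>2) / 2)"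
      proof -
        have gen: "- (k * e) \<le> X / 2 - Y / 2" if "Y \<le> k + k * e" "k - k * e \<le> X" for X Y k :: real
          using that by linarith
        show ?thesis
          unfolding exp_le_cancel_iff using a b' by (intro gen) (simp_all add: algebra_simps)
      qed
    qed (use p in simp)
    also have "\<dots> = (\<Prod>t\<in>T. r (W t x) (V t x))"
      using fin by (simp add: r_eq prod.distrib exp_sum[symmetric] sum_subtractf sum_divide_distrib mult.commute)
    finally have "1 \<le> 1 / g * (\<Prod>t\<in>T. r (W t x) (V t x))"
      using g0 by (simp add: field_simps)
    then show "1 \<le> ennreal (1 / g) * ennreal (\<Prod>t\<in>T. r (W t x) (V t x))"
      using g0 by (simp add: ennreal_mult'[symmetric] del: ennreal_1 flip: ennreal_1)
  qed
  have rmeas: "(\<lambda>x. \<Prod>t\<in>T. r (W t x) (V t x)) \<in> borel_measurable M"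
    unfolding r_def by measurable
  have level: "{x \<in> space M. 1 \<le> ennreal (1 / g) * ennreal (F x)} \<in> sets M" if "F \<in> borel_measurable M" for F
    using that by measurable
  have "emeasure M ?E \<le> emeasure M {x \<in> space M. 1 \<le> ennreal (1 / g) * ennreal (\<Prod>t\<in>T. r (W t x) (V t x))}"
    by (intro emeasure_mono sub level rmeas)
  also have "\<dots> \<le> ennreal (1 / g) * (\<integral>\<^sup>+x. ennreal (\<Prod>t\<in>T. r (W t x) (V t x)) * indicator (space M) x \<partial>M)"
    using rmeas by (intro nn_integral_Markov_inequality) auto
  also have "\<dots> = ennreal (1 / g)"
    using total by (subst nn_integral_cong[where v="\<lambda>x. ennreal (\<Prod>t\<in>T. r (W t x) (V t x))"]) auto
  finally have "prob ?E \<le> 1 / g"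
    using g0 by (simp add: emeasure_eq_measure)
  also have "1 / g = (exp e / sqrt (1 + p)) ^ card T"
    by (simp add: g_def power_divide)
  finally show ?thesis .
qed

section \<open>Linear combinations of the coordinates of a product of standard normals\<close>

abbreviation std_normal :: "real measure" where
  "std_normal \<equiv> density lborel (\<lambda>x. ennreal (std_normal_density x))"

lemma prob_space_std_normal: "prob_space std_normal"
  by (rule prob_space_normal_density) simp

lemma prob_space_PiM_std_normal: "prob_space (PiM I (\<lambda>_. std_normal))"
  by (intro prob_space_PiM prob_space_std_normal)

lemma PiM_std_normal_coordinates:
  assumes "I \<noteq> {}"
  shows "prob_space.indep_vars (PiM I (\<lambda>_. std_normal)) (\<lambda>_. borel) (\<lambda>i \<omega>. \<omega> i) I"
    and "i \<in> I \<Longrightarrow> distributed (PiM I (\<lambda>_. std_normal)) lborel (\<lambda>\<omega>. \<omega> i) (\<lambda>x. ennreal (std_normal_density x))"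
proof -
  interpret P: prob_space "PiM I (\<lambda>_. std_normal)"
    by (rule prob_space_PiM_std_normal)
  have d: "distr (PiM I (\<lambda>_. std_normal)) lborel (\<lambda>\<omega>. \<omega> i) = std_normal" if "i \<in> I" for i
  proof -
    have "distr (PiM I (\<lambda>_. std_normal)) lborel (\<lambda>\<omega>. \<omega> i) = distr (PiM I (\<lambda>_. std_normal)) std_normal (\<lambda>\<omega>. \<omega> i)"
      by (rule distr_cong) auto
    also have "\<dots> = std_normal"
      by (rule distr_PiM_component) (use that prob_space_std_normal in auto)
    finally show ?thesis .
  qed
  show "i \<in> I \<Longrightarrow> distributed (PiM I (\<lambda>_. std_normal)) lborel (\<lambda>\<omega>. \<omega> i) (\<lambda>x. ennreal (std_normal_density x))"
    using d by (auto simp: distributed_def)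
  have m: "(\<lambda>\<omega>. \<omega> i) \<in> borel_measurable (PiM I (\<lambda>_. std_normal))" if "i \<in> I" for i
    using measurable_component_singleton[OF that, of "\<lambda>_. std_normal"] by simp
  have "distr (PiM I (\<lambda>_. std_normal)) (PiM I (\<lambda>_. std_normal)) (\<lambda>x. \<lambda>i\<in>I. x i) = PiM I (\<lambda>_. std_normal)"
    by (subst distr_cong[where g="\<lambda>x. x"]) (auto simp: space_PiM PiE_restrict)
  moreover have "PiM I (\<lambda>i. distr (PiM I (\<lambda>_. std_normal)) std_normal (\<lambda>\<omega>. \<omega> i)) = PiM I (\<lambda>_. std_normal)"
    by (intro PiM_cong refl distr_PiM_component prob_space_std_normal)
  ultimately have "P.indep_vars (\<lambda>_. std_normal) (\<lambda>i \<omega>. \<omega> i) I"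
    by (subst P.indep_vars_iff_distr_eq_PiM'[OF assms]) auto
  from P.indep_vars_compose2[OF this, of "\<lambda>_ x. x" "\<lambda>_. borel"]
  show "P.indep_vars (\<lambda>_. borel) (\<lambda>i \<omega>. \<omega> i) I" by simp
qed

text \<open>Disjoint supports \<open>K t\<close> give independence. Nonempty supports and nonzero
  coefficients keep every variance positive, so that each sum has a normal density.\<close>

lemma PiM_std_normal_linear_combinations:
  fixes c :: "'t \<Rightarrow> 'k \<Rightarrow> real"
  assumes ne: "I \<noteq> {}" and K: "\<And>t. t \<in> T \<Longrightarrow> K t \<subseteq> I" "\<And>t. t \<in> T \<Longrightarrow> finite (K t)" "\<And>t. t \<in> T \<Longrightarrow> K t \<noteq> {}"
    and disj: "disjoint_family_on K T" and c: "\<And>t k. t \<in> T \<Longrightarrow> k \<in> K t \<Longrightarrow> c t k \<noteq> 0"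
  shows "prob_space.indep_vars (PiM I (\<lambda>_. std_normal)) (\<lambda>_. borel) (\<lambda>t \<omega>. \<Sum>k\<in>K t. c t k * \<omega> k) T"
    and "t \<in> T \<Longrightarrow> distributed (PiM I (\<lambda>_. std_normal)) lborel (\<lambda>\<omega>. \<Sum>k\<in>K t. c t k * \<omega> k)
            (\<lambda>x. ennreal (normal_density 0 (sqrt (\<Sum>k\<in>K t. (c t k)\<^sup>2)) x))"
proof -
  interpret P: prob_space "PiM I (\<lambda>_. std_normal)"
    by (rule prob_space_PiM_std_normal)
  note ind = PiM_std_normal_coordinates(1)[OF ne]
  have "P.indep_vars (\<lambda>t. PiM (K t) (\<lambda>_. borel)) (\<lambda>t \<omega>. restrict (\<lambda>i. \<omega> i) (K t)) T"
    by (rule P.indep_vars_restrict[OF ind]) (use K disj in auto)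
  from P.indep_vars_compose2[OF this, of "\<lambda>t f. \<Sum>k\<in>K t. c t k * f k" "\<lambda>_. borel"]
  have "P.indep_vars (\<lambda>_. borel) (\<lambda>t \<omega>. \<Sum>k\<in>K t. c t k * restrict (\<lambda>i. \<omega> i) (K t) k) T"
    by simp
  then show "P.indep_vars (\<lambda>_. borel) (\<lambda>t \<omega>. \<Sum>k\<in>K t. c t k * \<omega> k) T"
    by (simp cong: sum.cong)
  assume t: "t \<in> T"
  have 1: "P.indep_vars (\<lambda>_. borel) (\<lambda>k \<omega>. c t k * \<omega> k) (K t)"
    using P.indep_vars_compose2[OF P.indep_vars_subset[OF ind K(1)[OF t]], of "\<lambda>k x. c t k * x" "\<lambda>_. borel"]
    by simp
  have 2: "distributed (PiM I (\<lambda>_. std_normal)) lborel (\<lambda>\<omega>. c t k * \<omega> k) (\<lambda>x. ennreal (normal_density 0 \<bar>c t k\<bar> x))"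
    if "k \<in> K t" for k
    using P.normal_density_affine[OF PiM_std_normal_coordinates(2)[OF ne], of k "c t k" 0] K(1)[OF t] c[OF t that] that by auto
  show "distributed (PiM I (\<lambda>_. std_normal)) lborel (\<lambda>\<omega>. \<Sum>k\<in>K t. c t k * \<omega> k)
            (\<lambda>x. ennreal (normal_density 0 (sqrt (\<Sum>k\<in>K t. (c t k)\<^sup>2)) x))"
    using P.sum_indep_normal[OF K(2)[OF t] K(3)[OF t] 1, of "\<lambda>k. \<bar>c t k\<bar>" "\<lambda>_. 0"] 2 c[OF t] by simp
qed

section \<open>Testing Gaussian codewords over one block\<close>

text \<open>The residual subtracts from the output y the contributions of the users outside S. If x carries
  the true codewords, its average energy is close to 1 plus the received power of S. The test
  asks for an upper bound for S empty and lower bounds for all S; together these two bounds, for S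
  the set of users whose codeword is wrong, force a large likelihood ratio.\<close>

definition residual :: "nat set \<Rightarrow> (nat \<Rightarrow> real) \<Rightarrow> (nat \<Rightarrow> nat \<Rightarrow> real) \<Rightarrow> (nat \<Rightarrow> real) \<Rightarrow> nat set \<Rightarrow> nat \<Rightarrow> real" where
  "residual J a x y S t = y t - (\<Sum>j\<in>J - S. a j * x j t)"

definition plausible :: "nat \<Rightarrow> real \<Rightarrow> nat set \<Rightarrow> (nat \<Rightarrow> real) \<Rightarrow> (nat \<Rightarrow> nat \<Rightarrow> real) \<Rightarrow> (nat \<Rightarrow> real) \<Rightarrow> bool" where
  "plausible N e J a x y \<longleftrightarrow>
     (\<Sum>t<N. (residual J a x y {} t)\<^sup>2) \<le> real N * (1 + e) \<and>
     (\<forall>S\<in>Pow J. (\<Sum>t<N. (residual J a x y S t)\<^sup>2) \<ge> real N * (1 + (\<Sum>j\<in>S. (a j)\<^sup>2)) * (1 - e))"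

lemma plausible_sets:
  assumes J: "finite J" and y: "\<And>t. t < N \<Longrightarrow> (\<lambda>\<omega>. y \<omega> t) \<in> borel_measurable M"
    and x: "\<And>j t. j \<in> J \<Longrightarrow> t < N \<Longrightarrow> (\<lambda>\<omega>. x \<omega> j t) \<in> borel_measurable M"
  shows "{\<omega> \<in> space M. plausible N e J a (x \<omega>) (y \<omega>)} \<in> sets M"
proof -
  have "(\<lambda>\<omega>. residual J a (x \<omega>) (y \<omega>) S t) \<in> borel_measurable M" if "t < N" for S t
    unfolding residual_def using that
    by (intro borel_measurable_diff y borel_measurable_sum borel_measurable_times borel_measurable_const x) auto
  then have sq: "(\<lambda>\<omega>. \<Sum>t<N. (residual J a (x \<omega>) (y \<omega>) S t)\<^sup>2) \<in> borel_measurable M" for S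
    by (intro borel_measurable_sum borel_measurable_power) auto
  show ?thesis
    unfolding plausible_def
    by (intro sets.sets_Collect_conj sets.sets_Collect_finite_All borel_measurable_le sq borel_measurable_const)
      (use J in auto)
qed

text \<open>The coordinate of symbol t of codeword m of user j is \<open>\<kappa> j m t\<close>, and \<open>\<zeta> t\<close> is the coordinate of the
  noise at time t; codebook and noise are coordinates of a single product of standard normals.\<close>

locale gaussian_block =
  fixes I :: "'k set" and \<kappa> :: "nat \<Rightarrow> nat \<Rightarrow> nat \<Rightarrow> 'k" and \<zeta> :: "nat \<Rightarrow> 'k"
    and N :: nat and J :: "nat set" and Ms :: "nat \<Rightarrow> nat set" and a :: "nat \<Rightarrow> real"
  assumes \<kappa>_eq: "\<kappa> j m t = \<kappa> j' m' t' \<longleftrightarrow> j = j' \<and> m = m' \<and> t = t'"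
    and \<zeta>_eq: "\<zeta> t = \<zeta> t' \<longleftrightarrow> t = t'"
    and \<kappa>_\<zeta>: "\<kappa> j m t \<noteq> \<zeta> t'"
    and \<kappa>_I: "j \<in> J \<Longrightarrow> m \<in> Ms j \<Longrightarrow> t < N \<Longrightarrow> \<kappa> j m t \<in> I"
    and \<zeta>_I: "t < N \<Longrightarrow> \<zeta> t \<in> I"
    and finite_J: "finite J" and a_nz: "j \<in> J \<Longrightarrow> a j \<noteq> 0" and N_pos: "0 < N"
begin

abbreviation \<Omega> :: "('k \<Rightarrow> real) measure" where "\<Omega> \<equiv> PiM I (\<lambda>_. std_normal)"

definition received :: "(nat \<Rightarrow> nat) \<Rightarrow> ('k \<Rightarrow> real) \<Rightarrow> nat \<Rightarrow> real" where
  "received d \<omega> t = (\<Sum>j\<in>J. a j * \<omega> (\<kappa> j (d j) t)) + \<omega> (\<zeta> t)"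

definition Pw :: "nat set \<Rightarrow> real" where "Pw S = (\<Sum>j\<in>S. (a j)\<^sup>2)"

sublocale prob_space \<Omega>
  by (rule prob_space_PiM_std_normal)

lemma \<zeta>_\<kappa>: "\<zeta> t' \<noteq> \<kappa> j m t"
  using \<kappa>_\<zeta> by metis

lemma I_nonempty: "I \<noteq> {}"
  using \<zeta>_I[OF N_pos] by auto

lemma Pw_pos: "S \<subseteq> J \<Longrightarrow> S \<noteq> {} \<Longrightarrow> 0 < Pw S"
  unfolding Pw_def using finite_J a_nz by (intro sum_pos) (auto dest: finite_subset)

lemma Pw_nonneg: "0 \<le> Pw S"
  unfolding Pw_def by (intro sum_nonneg) auto

text \<open>The wrong codewords occupy other coordinates than the true codewords and the noise,
  because \<open>d'\<close> differs from \<open>d\<close> throughout \<open>S\<close>; different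
  times use different coordinates as well. All 2N variables are thus linear combinations with
  disjoint supports.\<close>

lemma signal_normal:
  assumes S: "S \<subseteq> J" "S \<noteq> {}" and d: "\<And>j. j \<in> J \<Longrightarrow> d j \<in> Ms j" "\<And>j. j \<in> J \<Longrightarrow> d' j \<in> Ms j"
    and ne: "\<And>j. j \<in> S \<Longrightarrow> d' j \<noteq> d j"
  shows "indep_vars (\<lambda>_. borel) (\<lambda>(b, t). if b then (\<lambda>\<omega>. (\<Sum>j\<in>S. a j * \<omega> (\<kappa> j (d j) t)) + \<omega> (\<zeta> t))
        else (\<lambda>\<omega>. \<Sum>j\<in>S. a j * \<omega> (\<kappa> j (d' j) t))) (UNIV \<times> {..<N})" (is "indep_vars _ ?F _")
    and "t < N \<Longrightarrow> distributed \<Omega> lborel (\<lambda>\<omega>. \<Sum>j\<in>S. a j * \<omega> (\<kappa> j (d' j) t))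
         (\<lambda>x. ennreal (normal_density 0 (sqrt (Pw S)) x))"
proof -
  define K where "K = (\<lambda>(b, t). if b then insert (\<zeta> t) ((\<lambda>j. \<kappa> j (d j) t) ` S) else (\<lambda>j. \<kappa> j (d' j) t) ` S)"
  \<comment> \<open>\<open>uj\<close> reads the user off a coordinate, which turns the gains into
    coefficients indexed by coordinates; noise coordinates get the coefficient 1.\<close>
  define uj where "uj k = (SOME j. \<exists>m t. k = \<kappa> j m t)" for k
  have uj: "uj (\<kappa> j m t) = j" for j m t
    unfolding uj_def by (rule some_equality) (auto simp: \<kappa>_eq)
  define c where "c = (\<lambda>(b::bool, t::nat) k. if k \<in> range \<zeta> then 1 else a (uj k))"
  have c_\<zeta>: "c bt (\<zeta> t) = 1" for bt t
    by (auto simp: c_def split: prod.splits)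
  have c_\<kappa>: "c bt (\<kappa> j m t) = a j" for bt t j m
    by (auto simp: c_def uj \<kappa>_\<zeta> split: prod.splits)
  have finS: "finite S"
    using S finite_J by (auto dest: finite_subset)
  have inj: "inj_on (\<lambda>j. \<kappa> j (f j) t) S" for f t
    by (auto simp: inj_on_def \<kappa>_eq)
  have F: "?F = (\<lambda>bt \<omega>. \<Sum>k\<in>K bt. c bt k * \<omega> k)"
  proof (intro ext, clarify)
    fix b t \<omega>
    show "(if b then (\<lambda>\<omega>. (\<Sum>j\<in>S. a j * \<omega> (\<kappa> j (d j) t)) + \<omega> (\<zeta> t))
        else (\<lambda>\<omega>. \<Sum>j\<in>S. a j * \<omega> (\<kappa> j (d' j) t))) \<omega> = (\<Sum>k\<in>K (b, t). c (b, t) k * \<omega> k)"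
      using finS by (auto simp: K_def sum.reindex[OF inj] c_\<kappa> c_\<zeta> \<zeta>_\<kappa> image_iff)
  qed
  have K1: "K bt \<subseteq> I" if "bt \<in> UNIV \<times> {..<N}" for bt
    using that S by (auto simp: K_def split: if_splits intro!: \<kappa>_I \<zeta>_I d)
  have K2: "finite (K bt)" if "bt \<in> UNIV \<times> {..<N}" for bt
    using finS by (auto simp: K_def split: prod.splits)
  have K3: "K bt \<noteq> {}" if "bt \<in> UNIV \<times> {..<N}" for bt
    using S by (auto simp: K_def split: prod.splits)
  have K4: "disjoint_family_on K (UNIV \<times> {..<N})"
    using ne ne[symmetric] by (auto simp: disjoint_family_on_def K_def \<kappa>_eq \<zeta>_eq \<kappa>_\<zeta> \<zeta>_\<kappa> split: if_splits)
  have K5: "c bt k \<noteq> 0" if "bt \<in> UNIV \<times> {..<N}" "k \<in> K bt" for bt k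
    using that S a_nz by (auto simp: K_def c_\<kappa> c_\<zeta> split: prod.splits if_splits)
  note L = PiM_std_normal_linear_combinations[where c=c, OF I_nonempty K1 K2 K3 K4 K5]
  show "indep_vars (\<lambda>_. borel) ?F (UNIV \<times> {..<N})"
    unfolding F by (rule L(1))
  assume "t < N"
  then have "distributed \<Omega> lborel (\<lambda>\<omega>. \<Sum>k\<in>K (False, t). c (False, t) k * \<omega> k)
            (\<lambda>x. ennreal (normal_density 0 (sqrt (\<Sum>k\<in>K (False, t). (c (False, t) k)\<^sup>2)) x))"
    by (intro L(2)) auto
  moreover have "(\<Sum>k\<in>K (False, t). c (False, t) k * \<omega> k) = (\<Sum>j\<in>S. a j * \<omega> (\<kappa> j (d' j) t))" for \<omega>
    by (simp add: K_def sum.reindex[OF inj] c_\<kappa>)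
  moreover have "(\<Sum>k\<in>K (False, t). (c (False, t) k)\<^sup>2) = Pw S"
    by (simp add: K_def sum.reindex[OF inj] c_\<kappa> Pw_def)
  ultimately show "distributed \<Omega> lborel (\<lambda>\<omega>. \<Sum>j\<in>S. a j * \<omega> (\<kappa> j (d' j) t))
         (\<lambda>x. ennreal (normal_density 0 (sqrt (Pw S)) x))"
    by simp
qed

text \<open>In contrast to \<open>signal_normal\<close> the set \<open>S\<close> may be empty: the
  output is then pure noise, the case behind the upper bound in the test.\<close>

lemma output_normal:
  assumes S: "S \<subseteq> J" and d: "\<And>j. j \<in> J \<Longrightarrow> d j \<in> Ms j"
  shows "indep_vars (\<lambda>_. borel) (\<lambda>t \<omega>. (\<Sum>j\<in>S. a j * \<omega> (\<kappa> j (d j) t)) + \<omega> (\<zeta> t)) {..<N}" (is "indep_vars _ ?F _")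
    and "t < N \<Longrightarrow> distributed \<Omega> lborel (\<lambda>\<omega>. (\<Sum>j\<in>S. a j * \<omega> (\<kappa> j (d j) t)) + \<omega> (\<zeta> t))
         (\<lambda>x. ennreal (normal_density 0 (sqrt (1 + Pw S)) x))"
proof -
  define K where "K = (\<lambda>t. insert (\<zeta> t) ((\<lambda>j. \<kappa> j (d j) t) ` S))"
  define uj where "uj k = (SOME j. \<exists>m t. k = \<kappa> j m t)" for k
  have uj: "uj (\<kappa> j m t) = j" for j m t
    unfolding uj_def by (rule some_equality) (auto simp: \<kappa>_eq)
  define c where "c = (\<lambda>(t::nat) k. if k \<in> range \<zeta> then 1 else a (uj k))"
  have c_\<zeta>: "c bt (\<zeta> t) = 1" for bt t
    by (auto simp: c_def)
  have c_\<kappa>: "c bt (\<kappa> j m t) = a j" for bt t j m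
    by (auto simp: c_def uj \<kappa>_\<zeta>)
  have finS: "finite S"
    using S finite_J by (auto dest: finite_subset)
  have inj: "inj_on (\<lambda>j. \<kappa> j (f j) t) S" for f t
    by (auto simp: inj_on_def \<kappa>_eq)
  have sumK: "(\<Sum>k\<in>K t. f k) = (\<Sum>j\<in>S. f (\<kappa> j (d j) t)) + f (\<zeta> t)" for t and f :: "'k \<Rightarrow> real"
    using finS by (auto simp: K_def sum.reindex[OF inj] \<zeta>_\<kappa> image_iff)
  have K1: "K t \<subseteq> I" if "t \<in> {..<N}" for t
    using that S by (auto simp: K_def intro!: \<kappa>_I \<zeta>_I d)
  have K2: "finite (K t)" if "t \<in> {..<N}" for t
    using finS by (auto simp: K_def)
  have K3: "K t \<noteq> {}" if "t \<in> {..<N}" for t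
    by (auto simp: K_def)
  have K4: "disjoint_family_on K {..<N}"
    by (auto simp: disjoint_family_on_def K_def \<kappa>_eq \<zeta>_eq \<kappa>_\<zeta> \<zeta>_\<kappa>)
  have K5: "c t k \<noteq> 0" if "t \<in> {..<N}" "k \<in> K t" for t k
    using that S a_nz by (auto simp: K_def c_\<kappa> c_\<zeta>)
  note L = PiM_std_normal_linear_combinations[where c=c, OF I_nonempty K1 K2 K3 K4 K5, unfolded sumK c_\<kappa> c_\<zeta>]
  show "indep_vars (\<lambda>_. borel) ?F {..<N}"
    using L(1) by simp
  assume "t < N"
  then show "distributed \<Omega> lborel (\<lambda>\<omega>. (\<Sum>j\<in>S. a j * \<omega> (\<kappa> j (d j) t)) + \<omega> (\<zeta> t))
         (\<lambda>x. ennreal (normal_density 0 (sqrt (1 + Pw S)) x))"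
    using L(2)[of t] by (simp add: Pw_def add.commute)
qed

lemma output_deviation:
  assumes S: "S \<subseteq> J" and d: "\<And>j. j \<in> J \<Longrightarrow> d j \<in> Ms j" and e: "0 < e"
  shows "prob {\<omega> \<in> space \<Omega>. \<bar>(\<Sum>t<N. ((\<Sum>j\<in>S. a j * \<omega> (\<kappa> j (d j) t)) + \<omega> (\<zeta> t))\<^sup>2) - real N * (1 + Pw S)\<bar>
      \<ge> e * real N * (1 + Pw S)} \<le> 2 / (e\<^sup>2 * real N)"
proof -
  define W where "W t \<omega> = (\<Sum>j\<in>S. a j * \<omega> (\<kappa> j (d j) t)) + \<omega> (\<zeta> t)" for t \<omega>
  define s where "s = sqrt (1 + Pw S)"
  have s: "s > 0" "s\<^sup>2 = 1 + Pw S"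
    using Pw_nonneg[of S] by (auto simp: s_def)
  have 1: "indep_vars (\<lambda>_. borel) (\<lambda>t \<omega>. W t \<omega> / s) {..<N}"
    using indep_vars_compose2[OF output_normal(1)[OF S d], of "\<lambda>_ x. x / s" "\<lambda>_. borel"]
    by (simp add: W_def)
  have 2: "distributed \<Omega> lborel (\<lambda>\<omega>. W t \<omega> / s) (\<lambda>x. ennreal (std_normal_density x))" if "t < N" for t
    using normal_standard_normal_convert[OF s(1), of "W t" 0] output_normal(2)[OF S d that]
    by (simp add: W_def[abs_def] s_def)
  have "prob {\<omega> \<in> space \<Omega>. \<bar>(\<Sum>t<N. (W t \<omega> / s)\<^sup>2) - real (card {..<N})\<bar> \<ge> e * real (card {..<N})}
     \<le> 2 / (e\<^sup>2 * real (card {..<N}))"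
    using N_pos 2 e by (intro indep_std_normal_sum_squares_deviation[OF _ _ 1]) auto
  also have "{\<omega> \<in> space \<Omega>. \<bar>(\<Sum>t<N. (W t \<omega> / s)\<^sup>2) - real (card {..<N})\<bar> \<ge> e * real (card {..<N})}
    = {\<omega> \<in> space \<Omega>. \<bar>(\<Sum>t<N. (W t \<omega>)\<^sup>2) - real N * (1 + Pw S)\<bar> \<ge> e * real N * (1 + Pw S)}"
  proof (intro Collect_cong conj_cong refl)
    fix \<omega>
    have pos: "1 + Pw S > 0" using Pw_nonneg[of S] by simp
    have "(\<Sum>t<N. (W t \<omega> / s)\<^sup>2) - real (card {..<N}) = ((\<Sum>t<N. (W t \<omega>)\<^sup>2) - real N * (1 + Pw S)) / (1 + Pw S)"
      using pos by (simp add: power_divide s(2) sum_divide_distrib[symmetric] field_simps)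
    then show "(e * real (card {..<N}) \<le> \<bar>(\<Sum>t<N. (W t \<omega> / s)\<^sup>2) - real (card {..<N})\<bar>)
      = (e * real N * (1 + Pw S) \<le> \<bar>(\<Sum>t<N. (W t \<omega>)\<^sup>2) - real N * (1 + Pw S)\<bar>)"
      using pos by (simp only: abs_divide abs_of_pos pos_le_divide_eq card_lessThan)
  qed
  finally show ?thesis
    by (simp add: W_def)
qed

lemma residual_true:
  assumes "S \<subseteq> J"
  shows "residual J a (\<lambda>j t. \<omega> (\<kappa> j (d j) t)) (received d \<omega>) S t = (\<Sum>j\<in>S. a j * \<omega> (\<kappa> j (d j) t)) + \<omega> (\<zeta> t)"
  using sum.subset_diff[OF assms finite_J, of "\<lambda>j. a j * \<omega> (\<kappa> j (d j) t)"]
  by (simp add: residual_def received_def)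

lemma coordinate_measurable: "k \<in> I \<Longrightarrow> (\<lambda>\<omega>. \<omega> k) \<in> borel_measurable \<Omega>"
  using measurable_component_singleton[of k I "\<lambda>_. std_normal"] by simp

lemma plausible_event:
  assumes d: "\<And>j. j \<in> J \<Longrightarrow> d j \<in> Ms j" "\<And>j. j \<in> J \<Longrightarrow> d' j \<in> Ms j"
  shows "{\<omega> \<in> space \<Omega>. plausible N e J a (\<lambda>j t. \<omega> (\<kappa> j (d' j) t)) (received d \<omega>)} \<in> events"
proof -
  have r: "(\<lambda>\<omega>. received d \<omega> t) \<in> borel_measurable \<Omega>" if "t < N" for t
    unfolding received_def using that d
    by (intro borel_measurable_add borel_measurable_sum borel_measurable_times borel_measurable_const
        coordinate_measurable \<kappa>_I \<zeta>_I) auto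
  show ?thesis
    using d by (intro plausible_sets finite_J r coordinate_measurable \<kappa>_I) auto
qed

text \<open>For the true codewords the residual of \<open>S\<close> is the signal of
  \<open>S\<close> plus noise, so the test can fail only through a deviation event of
  \<open>output_deviation\<close>, one for each of the \<open>2 ^ card J\<close> subsets.\<close>

lemma true_not_plausible:
  assumes d: "\<And>j. j \<in> J \<Longrightarrow> d j \<in> Ms j" and e: "0 < e"
  shows "prob {\<omega> \<in> space \<Omega>. \<not> plausible N e J a (\<lambda>j t. \<omega> (\<kappa> j (d j) t)) (received d \<omega>)} \<le> 2 ^ card J * (2 / (e\<^sup>2 * real N))"
proof -
  define D where "D S = {\<omega> \<in> space \<Omega>. \<bar>(\<Sum>t<N. ((\<Sum>j\<in>S. a j * \<omega> (\<kappa> j (d j) t)) + \<omega> (\<zeta> t))\<^sup>2) - real N * (1 + Pw S)\<bar>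
      \<ge> e * real N * (1 + Pw S)}" for S
  have D_ev: "D S \<in> events" if "S \<subseteq> J" for S
  proof -
    have [measurable]: "(\<lambda>\<omega>. \<omega> (\<kappa> j (d j) t)) \<in> borel_measurable \<Omega>" if "j \<in> S" "t < N" for j t
      using coordinate_measurable \<kappa>_I d that \<open>S \<subseteq> J\<close> by auto
    have [measurable]: "(\<lambda>\<omega>. \<omega> (\<zeta> t)) \<in> borel_measurable \<Omega>" if "t < N" for t
      using coordinate_measurable \<zeta>_I that by auto
    show ?thesis unfolding D_def by measurable
  qed
  have "{\<omega> \<in> space \<Omega>. \<not> plausible N e J a (\<lambda>j t. \<omega> (\<kappa> j (d j) t)) (received d \<omega>)} \<subseteq> (\<Union>S\<in>Pow J. D S)"
  proof (rule subsetI, rule ccontr)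
    fix \<omega> assume "\<omega> \<in> {\<omega> \<in> space \<Omega>. \<not> plausible N e J a (\<lambda>j t. \<omega> (\<kappa> j (d j) t)) (received d \<omega>)}"
      and n2: "\<omega> \<notin> (\<Union>S\<in>Pow J. D S)"
    then have \<omega>: "\<omega> \<in> space \<Omega>" and n1: "\<not> plausible N e J a (\<lambda>j t. \<omega> (\<kappa> j (d j) t)) (received d \<omega>)"
      by auto
    have dev: "\<bar>(\<Sum>t<N. (residual J a (\<lambda>j t. \<omega> (\<kappa> j (d j) t)) (received d \<omega>) S t)\<^sup>2) - real N * (1 + Pw S)\<bar>
      < e * real N * (1 + Pw S)" if "S \<subseteq> J" for S
      using n2 that \<omega> by (auto simp: residual_true D_def not_le)
    have "(\<Sum>t<N. (residual J a (\<lambda>j t. \<omega> (\<kappa> j (d j) t)) (received d \<omega>) S t)\<^sup>2) \<le> real N * (1 + Pw S) * (1 + e)"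
      "(\<Sum>t<N. (residual J a (\<lambda>j t. \<omega> (\<kappa> j (d j) t)) (received d \<omega>) S t)\<^sup>2) \<ge> real N * (1 + Pw S) * (1 - e)"
      if "S \<subseteq> J" for S
    proof -
      have gen: "X \<le> k * (1 + e) \<and> k * (1 - e) \<le> X" if "\<bar>X - k\<bar> < e * k" for X k :: real
        using that by (simp add: abs_less_iff algebra_simps)
      show "(\<Sum>t<N. (residual J a (\<lambda>j t. \<omega> (\<kappa> j (d j) t)) (received d \<omega>) S t)\<^sup>2) \<le> real N * (1 + Pw S) * (1 + e)"
        "(\<Sum>t<N. (residual J a (\<lambda>j t. \<omega> (\<kappa> j (d j) t)) (received d \<omega>) S t)\<^sup>2) \<ge> real N * (1 + Pw S) * (1 - e)"
        using gen[OF dev[OF that, unfolded mult.assoc[of e]]] by auto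
    qed
    from this(1)[of "{}"] this(2) n1 show "False"
      by (auto simp: plausible_def Pw_def)
  qed
  then have "prob {\<omega> \<in> space \<Omega>. \<not> plausible N e J a (\<lambda>j t. \<omega> (\<kappa> j (d j) t)) (received d \<omega>)} \<le> prob (\<Union>S\<in>Pow J. D S)"
    using D_ev finite_J by (intro finite_measure_mono sets.finite_UN) auto
  also have "\<dots> \<le> (\<Sum>S\<in>Pow J. prob (D S))"
    using D_ev finite_J by (intro finite_measure_subadditive_finite) auto
  also have "\<dots> \<le> (\<Sum>S\<in>Pow J. 2 / (e\<^sup>2 * real N))"
    using output_deviation[OF _ d e] by (intro sum_mono) (auto simp: D_def)
  also have "\<dots> = 2 ^ card J * (2 / (e\<^sup>2 * real N))"
    using finite_J by (simp add: card_Pow)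
  finally show ?thesis .
qed

text \<open>Outside \<open>S\<close> the two choices of codewords agree and cancel. The residual of
  \<open>S\<close> is then the true signal of \<open>S\<close> plus noise, \<open>W\<close>, and the
  residual of the empty set is \<open>W - V\<close> with \<open>V\<close> the wrong signal. Passing
  these two checks is the event of \<open>indep_normal_confusion\<close> with
  \<open>p = Pw S\<close>.\<close>

lemma wrong_plausible:
  assumes d: "\<And>j. j \<in> J \<Longrightarrow> d j \<in> Ms j" "\<And>j. j \<in> J \<Longrightarrow> d' j \<in> Ms j"
    and S: "S = {j \<in> J. d' j \<noteq> d j}" "S \<noteq> {}"
  shows "prob {\<omega> \<in> space \<Omega>. plausible N e J a (\<lambda>j t. \<omega> (\<kappa> j (d' j) t)) (received d \<omega>)} \<le> (exp e / sqrt (1 + Pw S)) ^ N"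
proof -
  define V where "V t \<omega> = (\<Sum>j\<in>S. a j * \<omega> (\<kappa> j (d' j) t))" for t \<omega>
  define W where "W t \<omega> = (\<Sum>j\<in>S. a j * \<omega> (\<kappa> j (d j) t)) + \<omega> (\<zeta> t)" for t \<omega>
  have SJ: "S \<subseteq> J" using S by auto
  have J: "(\<Sum>j\<in>J. f j) = (\<Sum>j\<in>J - S. f j) + (\<Sum>j\<in>S. f j)" for f :: "nat \<Rightarrow> real"
    using sum.subset_diff[OF SJ finite_J] .
  have eq: "(\<Sum>j\<in>J - S. a j * \<omega> (\<kappa> j (d' j) t)) = (\<Sum>j\<in>J - S. a j * \<omega> (\<kappa> j (d j) t))" for \<omega> t
    using S by (intro sum.cong) auto
  have rW: "residual J a (\<lambda>j t. \<omega> (\<kappa> j (d' j) t)) (received d \<omega>) S t = W t \<omega>" for \<omega> t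
    using residual_true[OF SJ, of \<omega> d t] eq[of \<omega> t] by (simp add: residual_def W_def)
  have rVW: "residual J a (\<lambda>j t. \<omega> (\<kappa> j (d' j) t)) (received d \<omega>) {} t = W t \<omega> - V t \<omega>" for \<omega> t
    using rW[of \<omega> t] J[of "\<lambda>j. a j * \<omega> (\<kappa> j (d' j) t)"] by (simp add: residual_def V_def)
  have ind: "indep_vars (\<lambda>_. borel) (\<lambda>(b, t). if b then W t else V t) (UNIV \<times> {..<N})"
    using signal_normal(1)[OF SJ S(2) d] S(1) unfolding W_def[abs_def] V_def[abs_def] by simp
  have V: "distributed \<Omega> lborel (V t) (\<lambda>x. ennreal (normal_density 0 (sqrt (Pw S)) x))" if "t \<in> {..<N}" for t
    using signal_normal(2)[OF SJ S(2) d, of t] S(1) that unfolding V_def[abs_def] by simp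
  have W: "distributed \<Omega> lborel (W t) (\<lambda>x. ennreal (normal_density 0 (sqrt (1 + Pw S)) x))" if "t \<in> {..<N}" for t
    using output_normal(2)[OF SJ d(1), of t] that unfolding W_def[abs_def] by simp
  have [measurable]: "V t \<in> borel_measurable \<Omega>" "W t \<in> borel_measurable \<Omega>" if "t \<in> {..<N}" for t
    using V[OF that] W[OF that] by (auto simp: distributed_def)
  have "prob {\<omega> \<in> space \<Omega>. plausible N e J a (\<lambda>j t. \<omega> (\<kappa> j (d' j) t)) (received d \<omega>)}
    \<le> prob {\<omega> \<in> space \<Omega>. (\<Sum>t\<in>{..<N}. (W t \<omega> - V t \<omega>)\<^sup>2) \<le> real (card {..<N}) * (1 + e) \<and>
      (\<Sum>t\<in>{..<N}. (W t \<omega>)\<^sup>2) \<ge> real (card {..<N}) * (1 + Pw S) * (1 - e)}"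
  proof (rule finite_measure_mono)
    show "{\<omega> \<in> space \<Omega>. plausible N e J a (\<lambda>j t. \<omega> (\<kappa> j (d' j) t)) (received d \<omega>)} \<subseteq>
      {\<omega> \<in> space \<Omega>. (\<Sum>t\<in>{..<N}. (W t \<omega> - V t \<omega>)\<^sup>2) \<le> real (card {..<N}) * (1 + e) \<and>
      (\<Sum>t\<in>{..<N}. (W t \<omega>)\<^sup>2) \<ge> real (card {..<N}) * (1 + Pw S) * (1 - e)}"
    proof clarify
      fix \<omega> assume pl: "plausible N e J a (\<lambda>j t. \<omega> (\<kappa> j (d' j) t)) (received d \<omega>)"
      have "(\<Sum>t<N. (residual J a (\<lambda>j t. \<omega> (\<kappa> j (d' j) t)) (received d \<omega>) S t)\<^sup>2)
         \<ge> real N * (1 + (\<Sum>j\<in>S. (a j)\<^sup>2)) * (1 - e)"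
        using pl SJ unfolding plausible_def by blast
      moreover have "(\<Sum>t<N. (residual J a (\<lambda>j t. \<omega> (\<kappa> j (d' j) t)) (received d \<omega>) {} t)\<^sup>2) \<le> real N * (1 + e)"
        using pl unfolding plausible_def by blast
      ultimately show "(\<Sum>t\<in>{..<N}. (W t \<omega> - V t \<omega>)\<^sup>2) \<le> real (card {..<N}) * (1 + e) \<and>
      (\<Sum>t\<in>{..<N}. (W t \<omega>)\<^sup>2) \<ge> real (card {..<N}) * (1 + Pw S) * (1 - e)"
        by (simp add: rW rVW Pw_def)
    qed
  qed measurable
  also have "\<dots> \<le> (exp e / sqrt (1 + Pw S)) ^ card {..<N}"
    by (rule indep_normal_confusion[OF _ ind V W Pw_pos[OF SJ S(2)]]) auto
  finally show ?thesis by simp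
qed

end

section \<open>The block decode-and-forward code\<close>

text \<open>The set of candidates that pass takes finitely many values, each on a measurable set.
  Hence any function of it is measurable, in particular a decoder that picks a candidate by
  \<open>SOME\<close>.\<close>

lemma measurable_finite_test_set:
  assumes fin: "finite A" and Q: "\<And>x. x \<in> A \<Longrightarrow> {y \<in> space M. Q x y} \<in> sets M"
    and F: "\<And>X. F X \<in> space N"
  shows "(\<lambda>y. F {x \<in> A. Q x y}) \<in> measurable M N"
proof -
  have "(\<lambda>y. {x \<in> A. Q x y}) \<in> measurable M (count_space (Pow A))"
  proof (subst measurable_count_space_eq2)
    show "finite (Pow A)" using fin by simp
    have "(\<lambda>y. {x \<in> A. Q x y}) -` {X} \<inter> space M \<in> sets M" if X: "X \<subseteq> A" for X
    proof -
      have "{y \<in> space M. \<forall>x\<in>A. Q x y \<longleftrightarrow> x \<in> X} \<in> sets M"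
      proof (rule sets.sets_Collect_finite_All)
        fix x assume "x \<in> A"
        then show "{y \<in> space M. Q x y \<longleftrightarrow> x \<in> X} \<in> sets M"
          using Q sets.sets_Collect_neg[OF Q] by (cases "x \<in> X") auto
      qed (rule fin)
      also have "{y \<in> space M. \<forall>x\<in>A. Q x y \<longleftrightarrow> x \<in> X} = (\<lambda>y. {x \<in> A. Q x y}) -` {X} \<inter> space M"
        using X by auto
      finally show ?thesis .
    qed
    then show "(\<lambda>y. {x \<in> A. Q x y}) \<in> space M \<rightarrow> Pow A \<and> (\<forall>X\<in>Pow A. (\<lambda>y. {x \<in> A. Q x y}) -` {X} \<inter> space M \<in> sets M)"
      by auto
  qed
  then show ?thesis
    by (rule measurable_compose) (use F in auto)
qed

lemma plausible_cong:
  assumes "\<And>t. t < N \<Longrightarrow> y t = y' t" "\<And>j t. j \<in> J \<Longrightarrow> t < N \<Longrightarrow> x j t = x' j t"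
  shows "plausible N e J a x y = plausible N e J a x' y'"
proof -
  have "residual J a x y S t = residual J a x' y' S t" if "t < N" for S t
    using assms that by (auto simp: residual_def intro!: sum.cong)
  then have "(\<Sum>t<N. (residual J a x y S t)\<^sup>2) = (\<Sum>t<N. (residual J a x' y' S t)\<^sup>2)" for S
    by (intro sum.cong) auto
  then show ?thesis
    by (simp add: plausible_def)
qed

text \<open>Each block keeps the budget by itself, and everything after block \<open>B\<close> is
  silent, including the remainder when \<open>n\<close> is not a multiple of the block
  length.\<close>

lemma block_energy:
  fixes F :: "nat \<Rightarrow> nat \<Rightarrow> real"
  assumes F: "\<And>b. (\<Sum>t<N. (F b t)\<^sup>2) \<le> real N * P" and F0: "\<And>b t. b > B \<Longrightarrow> F b t = 0"
    and n: "(B + 1) * N \<le> n" and N: "0 < N" and P: "0 \<le> P"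
  shows "(\<Sum>i<n. (F (i div N) (i mod N))\<^sup>2) \<le> real n * P"
proof -
  have blocks: "(\<Sum>i<k * N. (F (i div N) (i mod N))\<^sup>2) \<le> real (k * N) * P" for k
  proof (induction k)
    case (Suc k)
    have "(\<Sum>i<Suc k * N. (F (i div N) (i mod N))\<^sup>2) = (\<Sum>i<k * N. (F (i div N) (i mod N))\<^sup>2)
        + (\<Sum>i=k * N..<k * N + N. (F (i div N) (i mod N))\<^sup>2)"
      by (simp add: lessThan_atLeast0 sum.atLeastLessThan_concat add.commute)
    also have "(\<Sum>i=k * N..<k * N + N. (F (i div N) (i mod N))\<^sup>2) = (\<Sum>t<N. (F k t)\<^sup>2)"
      using N by (subst sum.atLeastLessThan_shift_0) (auto simp: lessThan_atLeast0 intro!: sum.cong)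
    finally show ?case
      using Suc F[of k] by (simp add: algebra_simps)
  qed simp
  have "(\<Sum>i<n. (F (i div N) (i mod N))\<^sup>2) = (\<Sum>i<(B + 1) * N. (F (i div N) (i mod N))\<^sup>2)"
  proof (rule sum.mono_neutral_right)
    show "\<forall>i\<in>{..<n} - {..<(B + 1) * N}. (F (i div N) (i mod N))\<^sup>2 = 0"
    proof
      fix i assume "i \<in> {..<n} - {..<(B + 1) * N}"
      then have "B + 1 \<le> i div N"
        using N by (simp add: less_eq_div_iff_mult_less_eq)
      then show "(F (i div N) (i mod N))\<^sup>2 = 0"
        using F0 by simp
    qed
  qed (use n in auto)
  also have "\<dots> \<le> real ((B + 1) * N) * P"
    by (rule blocks)
  also have "\<dots> \<le> real n * P"
    using n P by (intro mult_right_mono) (simp_all only: of_nat_le_iff)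
  finally show ?thesis .
qed

text \<open>An entry of the table never changes once it is written, so the recursion may be read at
  time \<open>t\<close> itself.\<close>

lemma ypast_received:
  assumes "t < i"
  shows "ypast h1 h2 h3 c m z i a t = (let X = xsym c m (ypast h1 h2 h3 c m z t) t in
     if a = 0 then h1 * X 1 + h2 * X 2 + h3 * X 3 + z (0, t) else gain h1 h2 h3 a * X 0 + z (a, t))"
  using assms
proof (induction i)
  case (Suc i)
  then show ?case
    by (cases "t = i") (auto simp: Let_def)
qed simp

text \<open>Rows 0 to 3 of the coordinate grid are the noise rows of the channel, hence the offset 4.\<close>

definition codeword_index :: "nat \<Rightarrow> nat \<Rightarrow> nat \<Rightarrow> nat \<times> nat" where
  "codeword_index j m t = (4 + prod_encode (j, m), t)"

text \<open>Packing the three digits into one number makes the relay a user 0 with codewords of its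
  own, so that one test and one error analysis serve both uplink and downlink.\<close>

definition relay_message :: "(nat \<Rightarrow> nat) \<Rightarrow> nat" where
  "relay_message D = prod_encode (D 1, prod_encode (D 2, D 3))"

lemma relay_message_eq: "relay_message D = relay_message D' \<longleftrightarrow> D 1 = D' 1 \<and> D 2 = D' 2 \<and> D 3 = D' 3"
  by (simp add: relay_message_def)

text \<open>The block length n is cut into \<open>B + 1\<close> blocks of length N; a message of user j is spread over B digits below \<open>L j\<close>.
  The relay forwards in block \<open>b + 1\<close> the digits that it decoded from block b. Codewords have average power
  \<open>q < P\<close>. Only users 1 and 2 decode (see \<open>three_rates\<close> below).\<close>

locale decode_forward =
  fixes h1 h2 h3 P q e \<beta> :: real and \<rho> :: "nat \<Rightarrow> real" and n N B :: nat and L Mz :: "nat \<Rightarrow> nat"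
    and \<phi> :: "nat \<Rightarrow> nat \<Rightarrow> nat \<Rightarrow> nat"
  assumes h_nz: "h1 \<noteq> 0" "h2 \<noteq> 0" "h3 \<noteq> 0"
    and q_pos: "0 < q" and e_pos: "0 < e" and q_P: "q * (1 + e) \<le> P" and \<beta>_nonneg: "0 \<le> \<beta>"
    and N_pos: "0 < N" and n_large: "(B + 1) * N \<le> n"
    and \<phi>_less: "j \<in> {1,2,3} \<Longrightarrow> m \<in> {1..Mz j} \<Longrightarrow> b < B \<Longrightarrow> \<phi> j m b < L j"
    and \<phi>_inj: "j \<in> {1,2,3} \<Longrightarrow> m \<in> {1..Mz j} \<Longrightarrow> m' \<in> {1..Mz j} \<Longrightarrow> (\<And>b. b < B \<Longrightarrow> \<phi> j m b = \<phi> j m' b) \<Longrightarrow> m = m'"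
    and L_le: "j \<in> {1,2,3} \<Longrightarrow> real (L j) \<le> 2 * 2 powr (real N * \<rho> j)"
    and uplink: "S \<subseteq> {1,2,3} \<Longrightarrow> S \<noteq> {} \<Longrightarrow>
        2 powr (\<Sum>j\<in>S. \<rho> j) * exp e \<le> \<beta> * sqrt (1 + (\<Sum>j\<in>S. (gain h1 h2 h3 j)\<^sup>2 * q))"
    and downlink: "j \<in> {1,2} \<Longrightarrow> 2 powr (\<Sum>k\<in>{1,2,3} - {j}. \<rho> k) * exp e \<le> \<beta> * sqrt (1 + (gain h1 h2 h3 j)\<^sup>2 * q)"
begin

abbreviation "hh \<equiv> gain h1 h2 h3"
abbreviation "\<kappa> \<equiv> codeword_index"

lemma hh_nz: "hh j \<noteq> 0"
  using h_nz by (simp add: gain_def)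

lemma P_pos: "0 < P"
  using q_pos e_pos q_P by (smt (verit) mult_pos_pos)

text \<open>Extensional functions, so that a candidate is determined by its three digits and
  equality of candidates is the right notion of correct decoding.\<close>

definition Cand :: "(nat \<Rightarrow> nat) set" where
  "Cand = PiE {1,2,3} (\<lambda>j. {..<L j})"

lemma finite_Cand: "finite Cand"
  unfolding Cand_def by (intro finite_PiE) auto

definition up_test :: "(nat \<times> nat \<Rightarrow> real) \<Rightarrow> (nat \<Rightarrow> real) \<Rightarrow> (nat \<Rightarrow> nat) \<Rightarrow> bool" where
  "up_test g y D = plausible N e {1,2,3} (\<lambda>j. hh j * sqrt q) (\<lambda>j t. g (\<kappa> j (D j) t)) y"

definition down_test :: "(nat \<times> nat \<Rightarrow> real) \<Rightarrow> nat \<Rightarrow> (nat \<Rightarrow> real) \<Rightarrow> (nat \<Rightarrow> nat) \<Rightarrow> bool" where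
  "down_test g j y D = plausible N e {0} (\<lambda>_. hh j * sqrt q) (\<lambda>k t. g (\<kappa> k (relay_message D) t)) y"

definition low_energy :: "(nat \<times> nat \<Rightarrow> real) \<Rightarrow> nat \<Rightarrow> nat \<Rightarrow> bool" where
  "low_energy g j m \<longleftrightarrow> (\<Sum>t<N. (sqrt q * g (\<kappa> j m t))\<^sup>2) \<le> real N * P"

definition word :: "(nat \<times> nat \<Rightarrow> real) \<Rightarrow> nat \<Rightarrow> nat \<Rightarrow> nat \<Rightarrow> real" where
  "word g j m t = (if low_energy g j m then sqrt q * g (\<kappa> j m t) else 0)"

definition message_of :: "nat \<Rightarrow> (nat \<Rightarrow> nat) \<Rightarrow> nat" where
  "message_of j f = (SOME m. m \<in> {1..Mz j} \<and> (\<forall>b<B. \<phi> j m b = f b))"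

text \<open>The entries 1 stand for the messages of rate zero (3 to 2, 1 to 3 and 2 to 3), which can
  take no other value.\<close>

definition decoded :: "nat \<Rightarrow> (nat \<times> (nat \<Rightarrow> nat)) set \<Rightarrow> nat \<times> nat" where
  "decoded j X = (let est = (\<lambda>k b. (SOME D. (b, D) \<in> X) k) in
     if j = 1 then (message_of 2 (est 2), message_of 3 (est 3))
     else if j = 2 then (message_of 1 (est 1), 1) else (1, 1))"

text \<open>The encoders silence a codeword that exceeds the power budget, while the decoders test against the
  original codebook: the power constraint then holds surely, and the error event only grows by the
  event that a transmitted codeword is silenced.\<close>

definition code :: "(nat \<times> nat \<Rightarrow> real) \<Rightarrow> ycode" where
  "code g = \<lparr> enc = (\<lambda>j i m m' y. if i div N < B then word g j (\<phi> j m (i div N)) (i mod N) else 0),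
     rel = (\<lambda>i y. if 0 < i div N \<and> i div N \<le> B
       then word g 0 (relay_message (SOME D. D \<in> {D \<in> Cand. up_test g (\<lambda>t. y ((i div N - 1) * N + t)) D})) (i mod N) else 0),
     dec = (\<lambda>j m m' y. decoded j {(b, D) \<in> {..<B} \<times> Cand. D j = \<phi> j m b \<and> down_test g j (\<lambda>t. y ((b + 1) * N + t)) D}) \<rparr>"

lemma word_energy: "(\<Sum>t<N. (word g j m t)\<^sup>2) \<le> real N * P"
  using P_pos by (cases "low_energy g j m") (simp_all add: word_def, simp add: low_energy_def)

lemma block_le:
  assumes "b < B" "t < N"
  shows "b * N + t < n" "(b + 1) * N + t < n" "b * N + t < (b + 1) * N"
proof -
  have "(b + 1) * N + t < (b + 2) * N"
    using assms by simp
  also have "\<dots> \<le> (B + 1) * N"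
    using assms by (intro mult_right_mono) auto
  also have "\<dots> \<le> n" by (rule n_large)
  finally show "(b + 1) * N + t < n" .
  then show "b * N + t < n" by simp
  show "b * N + t < (b + 1) * N" using assms by simp
qed

lemma code_measurable_code: "code_measurable n (code g)"
  unfolding code_measurable_def
proof (intro conjI allI)
  show "enc (code g) j i a b \<in> borel_measurable (PiM {..<i} (\<lambda>_. borel))" for j i a b
    by (simp add: code_def)
  show "rel (code g) i \<in> borel_measurable (PiM {..<i} (\<lambda>_. borel))" for i
  proof (cases "0 < i div N \<and> i div N \<le> B")
    case True
    have lt: "(i div N - 1) * N + t < i" if "t < N" for t
    proof -
      have "(i div N - 1) * N + t < (i div N - 1) * N + N" using that by simp
      also have "\<dots> = (i div N) * N" using True by (simp add: algebra_simps)
      also have "\<dots> \<le> i" by simp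
      finally show ?thesis .
    qed
    have "(\<lambda>y. (\<lambda>X. word g 0 (relay_message (SOME D. D \<in> X)) (i mod N))
       {D \<in> Cand. up_test g (\<lambda>t. y ((i div N - 1) * N + t)) D}) \<in> borel_measurable (PiM {..<i} (\<lambda>_. borel))"
      unfolding up_test_def
      by (rule measurable_finite_test_set[OF finite_Cand plausible_sets]) (use lt in auto)
    then show ?thesis using True by (simp add: code_def)
  next
    case False
    then have "rel (code g) i = (\<lambda>_. 0)" by (auto simp: code_def)
    then show ?thesis by simp
  qed
  show "dec (code g) j a b \<in> measurable (PiM {..<n} (\<lambda>_. borel)) (count_space UNIV)" for j a b
  proof -
    have "(\<lambda>y. decoded j {x \<in> {..<B} \<times> Cand. case x of (b, D) \<Rightarrow> D j = \<phi> j a b \<and> down_test g j (\<lambda>t. y ((b + 1) * N + t)) D})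
       \<in> measurable (PiM {..<n} (\<lambda>_. borel)) (count_space UNIV)"
    proof (rule measurable_finite_test_set)
      fix x assume "x \<in> {..<B} \<times> Cand"
      then obtain b D where x: "x = (b, D)" "b < B" "D \<in> Cand" by auto
      have "{y \<in> space (PiM {..<n} (\<lambda>_. borel)). down_test g j (\<lambda>t. y ((b + 1) * N + t)) D} \<in> sets (PiM {..<n} (\<lambda>_. borel))"
        unfolding down_test_def by (rule plausible_sets) (use block_le[OF x(2)] in auto)
      then show "{y \<in> space (PiM {..<n} (\<lambda>_. borel)). case x of (b, D) \<Rightarrow> D j = \<phi> j a b \<and> down_test g j (\<lambda>t. y ((b + 1) * N + t)) D}
          \<in> sets (PiM {..<n} (\<lambda>_. borel))"
        by (cases "D j = \<phi> j a b") (simp_all add: x(1))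
    qed (use finite_Cand in auto)
    moreover have "dec (code g) j a b = (\<lambda>y. decoded j {x \<in> {..<B} \<times> Cand. case x of (b, D) \<Rightarrow> D j = \<phi> j a b \<and> down_test g j (\<lambda>t. y ((b + 1) * N + t)) D})"
      by (auto simp: code_def intro!: ext arg_cong[where f="decoded j"])
    ultimately show ?thesis
      by simp
  qed
qed

lemma xsym_user: "a \<noteq> 0 \<Longrightarrow> xsym (code g) m Y i a = (if i div N < B then word g a (\<phi> a (m a (oth1 a)) (i div N)) (i mod N) else 0)"
  by (simp add: xsym_def code_def)

lemma relay_input:
  assumes "t < i"
  shows "ypast h1 h2 h3 (code g) m z i 0 t =
    (if t div N < B then \<Sum>j\<in>{1,2,3}. hh j * word g j (\<phi> j (m j (oth1 j)) (t div N)) (t mod N) else 0) + z (0, t)"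
  unfolding ypast_received[OF assms] Let_def by (simp add: xsym_user) (simp add: gain_def)

text \<open>The energy bound holds for every message and every noise realization, since overlong
  codewords are silenced; averaging then only has to exchange sums and integrals.\<close>

lemma power_ok_code:
  assumes fin: "finite (msgs n R)" and ne: "msgs n R \<noteq> {}"
  shows "power_ok h1 h2 h3 P n R (code g)"
  unfolding power_ok_def
proof
  fix a :: nat assume a: "a \<in> {0,1,2,3}"
  have n0: "0 < n"
    using n_large N_pos by (auto intro: gr0I)
  interpret noise: prob_space "noise n"
    unfolding noise_def by (rule prob_space_PiM_std_normal)
  define X where "X m i z = xsym (code g) m (ypast h1 h2 h3 (code g) m z i) i a" for m i z
  have energy: "(\<Sum>i<n. (X m i z)\<^sup>2) \<le> real n * P" for m z
  proof (cases "a = 0")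
    case True
    \<comment> \<open>\<open>block_energy\<close> needs symbols that depend on block and position
      only. The table is therefore read at the start \<open>b * N\<close> of the block, when the
      preceding block, which alone determines the relay's decision, is complete.\<close>
    define F where "F b t = (if 0 < b \<and> b \<le> B
       then word g 0 (relay_message (SOME D. D \<in> {D \<in> Cand. up_test g (\<lambda>t. (\<lambda>t. ypast h1 h2 h3 (code g) m z (b * N) 0 t) ((b - 1) * N + t)) D})) t else 0)" for b t
    have X: "X m i z = F (i div N) (i mod N)" for i
    proof (cases "0 < i div N \<and> i div N \<le> B")
      case c: True
      have less: "(i div N - 1) * N + t < i div N * N" "i div N * N \<le> i" if "t < N" for t
      proof -
        have "(i div N - 1) * N + t < (i div N - 1) * N + N" using that by simp
        also have "\<dots> = (i div N) * N" using c by (simp add: algebra_simps)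
        finally show "(i div N - 1) * N + t < i div N * N" .
      qed simp
      have "up_test g (\<lambda>t. restrict (ypast h1 h2 h3 (code g) m z i 0) {..<i} ((i div N - 1) * N + t)) D
        = up_test g (\<lambda>t. ypast h1 h2 h3 (code g) m z (i div N * N) 0 ((i div N - 1) * N + t)) D" for D
        unfolding up_test_def
      proof (rule plausible_cong)
        fix t assume t: "t < N"
        have "(i div N - 1) * N + t < i" using less[OF t] by linarith
        then show "restrict (ypast h1 h2 h3 (code g) m z i 0) {..<i} ((i div N - 1) * N + t)
          = ypast h1 h2 h3 (code g) m z (i div N * N) 0 ((i div N - 1) * N + t)"
          using less[OF t] by (simp add: relay_input)
      qed simp
      then show ?thesis
        using c True by (simp add: X_def xsym_def code_def F_def)
    next
      case False
      then show ?thesis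
        using True by (auto simp: X_def xsym_def code_def F_def)
    qed
    have "(\<Sum>t<N. (F b t)\<^sup>2) \<le> real N * P" for b
    proof (cases "0 < b \<and> b \<le> B")
      case True
      then show ?thesis using word_energy by (simp add: F_def)
    next
      case False
      then have "F b t = 0" for t by (auto simp: F_def)
      then show ?thesis using P_pos by simp
    qed
    then show ?thesis
      unfolding X using n_large N_pos P_pos by (intro block_energy[where B=B]) (auto simp: F_def)
  next
    case False
    define F where "F b t = (if b < B then word g a (\<phi> a (m a (oth1 a)) b) t else 0)" for b t
    have X: "X m i z = F (i div N) (i mod N)" for i
      using False by (simp add: X_def xsym_user F_def)
    have "(\<Sum>t<N. (F b t)\<^sup>2) \<le> real N * P" for b
    proof (cases "b < B")
      case True
      then show ?thesis using word_energy by (simp add: F_def)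
    next
      case False
      then have "F b t = 0" for t by (auto simp: F_def)
      then show ?thesis using P_pos by simp
    qed
    then show ?thesis
      unfolding X using n_large N_pos P_pos by (intro block_energy[where B=B]) (auto simp: F_def)
  qed
  have meas: "X m i \<in> borel_measurable (noise n)" if "i < n" for m i
  proof (cases "a = 0")
    case True
    have "(\<lambda>z. \<lambda>t\<in>{..<i}. ypast h1 h2 h3 (code g) m z i 0 t) \<in> measurable (noise n) (PiM {..<i} (\<lambda>_. borel))"
    proof (rule measurable_restrict)
      fix t assume t: "t \<in> {..<i}"
      have "(\<lambda>z. z (0, t)) \<in> borel_measurable (noise n)"
        using measurable_component_singleton[of "(0, t)" "{..<4} \<times> {..<n}" "\<lambda>_. std_normal"] t that
        by (simp add: noise_def)
      then show "(\<lambda>z. ypast h1 h2 h3 (code g) m z i 0 t) \<in> borel_measurable (noise n)"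
        using t by (simp add: relay_input)
    qed
    from measurable_compose[OF this, of "rel (code g) i"] code_measurable_code[of g] True
    show ?thesis by (simp add: X_def[abs_def] xsym_def code_measurable_def)
  next
    case False
    then show ?thesis by (simp add: X_def[abs_def] xsym_user)
  qed
  have total: "(\<Sum>i<n. \<integral>\<^sup>+z. ennreal ((X m i z)\<^sup>2) \<partial>noise n) \<le> ennreal (real n * P)" for m
  proof -
    have "(\<Sum>i<n. \<integral>\<^sup>+z. ennreal ((X m i z)\<^sup>2) \<partial>noise n) = (\<integral>\<^sup>+z. (\<Sum>i<n. ennreal ((X m i z)\<^sup>2)) \<partial>noise n)"
      using meas by (subst nn_integral_sum) auto
    also have "\<dots> \<le> (\<integral>\<^sup>+z. ennreal (real n * P) \<partial>noise n)"
      using energy by (intro nn_integral_mono) (simp add: sum_ennreal ennreal_leI)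
    also have "\<dots> = ennreal (real n * P)"
      by (simp add: noise.emeasure_space_1)
    finally show ?thesis .
  qed
  have c: "0 < card (msgs n R)" using fin ne by (simp add: card_gt_0_iff)
  have "(\<Sum>i<n. (\<Sum>m\<in>msgs n R. \<integral>\<^sup>+z. ennreal ((X m i z)\<^sup>2) \<partial>noise n) / ennreal (real (card (msgs n R))))
    = (\<Sum>m\<in>msgs n R. \<Sum>i<n. \<integral>\<^sup>+z. ennreal ((X m i z)\<^sup>2) \<partial>noise n) / ennreal (real (card (msgs n R)))"
    by (subst sum.swap) (simp add: divide_ennreal_def sum_distrib_right)
  also have "\<dots> \<le> (\<Sum>m\<in>msgs n R. ennreal (real n * P)) / ennreal (real (card (msgs n R)))"
    using total by (intro divide_right_mono_ennreal sum_mono) auto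
  also have "\<dots> = ennreal (real n * P)"
    using c P_pos by (simp add: ennreal_of_nat_eq_real_of_nat ennreal_mult'[symmetric] divide_ennreal)
  finally have "(\<Sum>i<n. (\<Sum>m\<in>msgs n R. \<integral>\<^sup>+z. ennreal ((X m i z)\<^sup>2) \<partial>noise n) / ennreal (real (card (msgs n R)))) / ennreal (real n)
     \<le> ennreal (real n * P) / ennreal (real n)"
    by (intro divide_right_mono_ennreal)
  also have "\<dots> = ennreal P"
    using n0 P_pos by (simp add: divide_ennreal)
  finally show "(\<Sum>i<n. (\<Sum>m\<in>msgs n R. \<integral>\<^sup>+z. ennreal ((xsym (code g) m (ypast h1 h2 h3 (code g) m z i) i a)\<^sup>2) \<partial>noise n)
     / ennreal (real (card (msgs n R)))) / ennreal (real n) \<le> ennreal P"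
    by (simp add: X_def)
qed

end

section \<open>Error probability of the random code\<close>

text \<open>A union bound over the true candidate failing and a wrong one passing. The map
  \<open>f\<close> from candidates to codeword indices covers both directions: on the uplink it
  gives each user its own digit, on the downlink it gives the relay the packed triple.\<close>

lemma (in gaussian_block) decoding_error:
  assumes fin: "finite Ca" and x: "x \<in> Ca" and f: "\<And>y j. y \<in> Ca \<Longrightarrow> j \<in> J \<Longrightarrow> f y j \<in> Ms j"
    and differ: "\<And>y. y \<in> Ca \<Longrightarrow> y \<noteq> x \<Longrightarrow> {j \<in> J. f y j \<noteq> f x j} \<noteq> {}" and e: "0 < e"
  defines "E \<equiv> {\<omega> \<in> space \<Omega>. \<not> (\<forall>y\<in>Ca. plausible N e J a (\<lambda>j t. \<omega> (\<kappa> j (f y j) t)) (received (f x) \<omega>) \<longleftrightarrow> y = x)}"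
  shows "E \<in> events"
    and "prob E \<le> 2 ^ card J * (2 / (e\<^sup>2 * real N))
      + (\<Sum>y\<in>Ca - {x}. (exp e / sqrt (1 + Pw {j \<in> J. f y j \<noteq> f x j})) ^ N)"
proof -
  define pl where "pl y = {\<omega> \<in> space \<Omega>. plausible N e J a (\<lambda>j t. \<omega> (\<kappa> j (f y j) t)) (received (f x) \<omega>)}" for y
  define npl where "npl = {\<omega> \<in> space \<Omega>. \<not> plausible N e J a (\<lambda>j t. \<omega> (\<kappa> j (f x j) t)) (received (f x) \<omega>)}"
  have pl_ev: "pl y \<in> events" if "y \<in> Ca" for y
    unfolding pl_def using plausible_event[of "f x" "f y"] f x that by auto
  have "npl = space \<Omega> - pl x"
    by (auto simp: npl_def pl_def)
  then have npl_ev: "npl \<in> events"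
    using pl_ev[OF x] by auto
  have E: "E = npl \<union> (\<Union>y\<in>Ca - {x}. pl y)"
    using x by (auto simp: E_def npl_def pl_def)
  show "E \<in> events"
    unfolding E using npl_ev pl_ev fin by auto
  have "prob E \<le> prob npl + prob (\<Union>y\<in>Ca - {x}. pl y)"
    unfolding E using npl_ev pl_ev fin by (intro measure_Un_le) auto
  also have "prob (\<Union>y\<in>Ca - {x}. pl y) \<le> (\<Sum>y\<in>Ca - {x}. prob (pl y))"
    using pl_ev fin by (intro finite_measure_subadditive_finite) auto
  also have "\<dots> \<le> (\<Sum>y\<in>Ca - {x}. (exp e / sqrt (1 + Pw {j \<in> J. f y j \<noteq> f x j})) ^ N)"
  proof (rule sum_mono)
    fix y assume "y \<in> Ca - {x}"
    then show "prob (pl y) \<le> (exp e / sqrt (1 + Pw {j \<in> J. f y j \<noteq> f x j})) ^ N"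
      unfolding pl_def using f x differ[of y] by (intro wrong_plausible) auto
  qed
  also have "prob npl \<le> 2 ^ card J * (2 / (e\<^sup>2 * real N))"
    unfolding npl_def using f x e by (intro true_not_plausible) auto
  finally show "prob E \<le> 2 ^ card J * (2 / (e\<^sup>2 * real N))
      + (\<Sum>y\<in>Ca - {x}. (exp e / sqrt (1 + Pw {j \<in> J. f y j \<noteq> f x j})) ^ N)"
    by simp
qed

context decode_forward
begin

section \<open>Ideal outputs and the error events of one block\<close>

definition digits :: "(nat \<Rightarrow> nat \<Rightarrow> nat) \<Rightarrow> nat \<Rightarrow> nat \<Rightarrow> nat" where
  "digits m b = (\<lambda>j\<in>{1,2,3}. \<phi> j (m j (oth1 j)) b)"

text \<open>The output if no codeword were silenced; it involves only coordinates of the probability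
  space, as does \<open>down_received\<close>, where moreover the relay is taken to have decoded
  correctly.\<close>

definition up_received :: "(nat \<times> nat \<Rightarrow> real) \<Rightarrow> (nat \<Rightarrow> nat) \<Rightarrow> nat \<Rightarrow> nat \<Rightarrow> real" where
  "up_received \<omega> D b t = (\<Sum>j\<in>{1,2,3}. hh j * sqrt q * \<omega> (\<kappa> j (D j) t)) + \<omega> (0, b * N + t)"

definition down_received :: "(nat \<times> nat \<Rightarrow> real) \<Rightarrow> nat \<Rightarrow> (nat \<Rightarrow> nat) \<Rightarrow> nat \<Rightarrow> nat \<Rightarrow> real" where
  "down_received \<omega> j D b t = hh j * sqrt q * \<omega> (\<kappa> 0 (relay_message D) t) + \<omega> (j, (b + 1) * N + t)"

definition up_ok :: "(nat \<times> nat \<Rightarrow> real) \<Rightarrow> (nat \<Rightarrow> nat) \<Rightarrow> nat \<Rightarrow> bool" where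
  "up_ok \<omega> D b \<longleftrightarrow> (\<forall>D'\<in>Cand. up_test \<omega> (up_received \<omega> D b) D' \<longleftrightarrow> D' = D)"

definition down_ok :: "(nat \<times> nat \<Rightarrow> real) \<Rightarrow> nat \<Rightarrow> (nat \<Rightarrow> nat) \<Rightarrow> nat \<Rightarrow> bool" where
  "down_ok \<omega> j D b \<longleftrightarrow> (\<forall>D'\<in>{D'\<in>Cand. D' j = D j}. down_test \<omega> j (down_received \<omega> j D b) D' \<longleftrightarrow> D' = D)"

definition block_ok :: "(nat \<times> nat \<Rightarrow> real) \<Rightarrow> (nat \<Rightarrow> nat) \<Rightarrow> nat \<Rightarrow> bool" where
  "block_ok \<omega> D b \<longleftrightarrow> low_energy \<omega> 0 (relay_message D) \<and> low_energy \<omega> 1 (D 1) \<and> low_energy \<omega> 2 (D 2) \<and> low_energy \<omega> 3 (D 3)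
     \<and> up_ok \<omega> D b \<and> down_ok \<omega> 1 D b \<and> down_ok \<omega> 2 D b"

definition valid_messages :: "(nat \<Rightarrow> nat \<Rightarrow> nat) \<Rightarrow> bool" where
  "valid_messages m \<longleftrightarrow> (\<forall>j\<in>{1,2,3}. m j (oth1 j) \<in> {1..Mz j}) \<and> m 3 2 = 1 \<and> m 1 3 = 1 \<and> m 2 3 = 1"

lemma digits_Cand:
  assumes "valid_messages m" "b < B"
  shows "digits m b \<in> Cand"
  unfolding digits_def Cand_def using assms by (auto simp: valid_messages_def intro!: \<phi>_less)

lemma message_of_eq:
  assumes j: "j \<in> {1,2,3}" and m: "m \<in> {1..Mz j}" and f: "\<And>b. b < B \<Longrightarrow> f b = \<phi> j m b"
  shows "message_of j f = m"
  unfolding message_of_def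
proof (rule some_equality)
  show "m \<in> {1..Mz j} \<and> (\<forall>b<B. \<phi> j m b = f b)"
    using m f by auto
  fix m' assume "m' \<in> {1..Mz j} \<and> (\<forall>b<B. \<phi> j m' b = f b)"
  then show "m' = m"
    using f by (intro \<phi>_inj[OF j _ m]) auto
qed

text \<open>In good blocks no codeword is silenced and exactly one candidate passes each test, so
  every \<open>SOME\<close> is forced and the actual outputs are the ideal ones. This needs no
  induction over the blocks: the users' symbols depend on the messages only, and the relay's symbols
  in block \<open>b + 1\<close> on what it received in block \<open>b\<close>.\<close>

lemma correct_decoding:
  assumes m: "valid_messages m" and ok: "\<And>b. b < B \<Longrightarrow> block_ok \<omega> (digits m b) b"
    and g: "\<And>j k t. \<omega> (\<kappa> j k t) = g (\<kappa> j k t)" and z: "\<And>a t. a < 4 \<Longrightarrow> t < n \<Longrightarrow> \<omega> (a, t) = z (a, t)"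
    and j: "j \<in> {1,2,3}"
  shows "dec (code g) j (m j (oth1 j)) (m j (oth2 j)) (restrict (ypast h1 h2 h3 (code g) m z n j) {..<n})
     = (m (oth1 j) j, m (oth2 j) j)"
proof -
  have le: "low_energy \<omega> = low_energy g"
    by (intro ext) (simp add: low_energy_def g)
  have up: "up_test \<omega> = up_test g" and down: "down_test \<omega> = down_test g"
    by (intro ext; simp add: up_test_def down_test_def g)+
  have dg: "digits m b k = \<phi> k (m k (oth1 k)) b" if "k \<in> {1,2,3}" for b k
    using that by (auto simp: digits_def)
  have word_user: "word g k (\<phi> k (m k (oth1 k)) b) t = sqrt q * \<omega> (\<kappa> k (digits m b k) t)"
    if "b < B" "k \<in> {1,2,3}" for b k t
    using ok[OF that(1)] that(2) dg[OF that(2), of b] by (auto simp: word_def block_ok_def le g)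
  have word_relay: "word g 0 (relay_message (digits m b)) t = sqrt q * \<omega> (\<kappa> 0 (relay_message (digits m b)) t)"
    if "b < B" for b t
    using ok[OF that] by (auto simp: word_def block_ok_def le g)
  have Y0: "ypast h1 h2 h3 (code g) m z i 0 (b * N + t) = up_received \<omega> (digits m b) b t"
    if b: "b < B" and t: "t < N" and i: "b * N + t < i" for b t i
  proof -
    have "(b * N + t) div N = b" "(b * N + t) mod N = t"
      using t by auto
    then show ?thesis
      using b word_user[OF b] z[OF _ block_le(1)[OF b t], of 0]
      unfolding relay_input[OF i] up_received_def by (simp add: mult.assoc)
  qed
  have Xr: "xsym (code g) m (ypast h1 h2 h3 (code g) m z ((b + 1) * N + t)) ((b + 1) * N + t) 0
      = sqrt q * \<omega> (\<kappa> 0 (relay_message (digits m b)) t)" if b: "b < B" and t: "t < N" for b t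
  proof -
    define i where "i = (b + 1) * N + t"
    have i: "i div N = b + 1" "i mod N = t"
      unfolding i_def using t by (simp_all only: div_mult_self3 mod_mult_self3 div_less mod_less)
    have "up_test g (\<lambda>s. restrict (ypast h1 h2 h3 (code g) m z i 0) {..<i} ((i div N - 1) * N + s)) D
      = up_test \<omega> (up_received \<omega> (digits m b) b) D" for D
      unfolding up unfolding up_test_def
    proof (rule plausible_cong)
      fix s assume s: "s < N"
      then have "b * N + s < i" using block_le(3)[OF b s] by (simp add: i_def)
      then show "restrict (ypast h1 h2 h3 (code g) m z i 0) {..<i} ((i div N - 1) * N + s) = up_received \<omega> (digits m b) b s"
        using Y0[OF b s] by (simp add: i)
    qed simp
    then have "{D \<in> Cand. up_test g (\<lambda>s. restrict (ypast h1 h2 h3 (code g) m z i 0) {..<i} ((i div N - 1) * N + s)) D} = {digits m b}"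
      using ok[OF b] digits_Cand[OF m b] by (auto simp: block_ok_def up_ok_def)
    moreover have "rel (code g) i y = word g 0 (relay_message (SOME D. D \<in> {D \<in> Cand. up_test g (\<lambda>t. y ((i div N - 1) * N + t)) D})) (i mod N)" for y
      using b i by (simp add: code_def)
    ultimately have "xsym (code g) m (ypast h1 h2 h3 (code g) m z i) i 0 = word g 0 (relay_message (SOME D. D \<in> {digits m b})) (i mod N)"
      unfolding xsym_def by (simp only: if_True refl)
    then show ?thesis
      unfolding i_def[symmetric] using word_relay[OF b] by (simp add: i(2))
  qed
  have Yj: "ypast h1 h2 h3 (code g) m z n j ((b + 1) * N + t) = down_received \<omega> j (digits m b) b t"
    if b: "b < B" and t: "t < N" for b t
    using ypast_received[OF block_le(2)[OF b t], of h1 h2 h3 "code g" m z j] Xr[OF b t] z[OF _ block_le(2)[OF b t], of j] j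
    by (auto simp: Let_def down_received_def)
  define X where "X = {(b, D) \<in> {..<B} \<times> Cand. D j = \<phi> j (m j (oth1 j)) b
    \<and> down_test g j (\<lambda>t. restrict (ypast h1 h2 h3 (code g) m z n j) {..<n} ((b + 1) * N + t)) D}"
  have dec: "dec (code g) j (m j (oth1 j)) (m j (oth2 j)) (restrict (ypast h1 h2 h3 (code g) m z n j) {..<n}) = decoded j X"
    by (simp add: code_def X_def)
  have est: "message_of k (\<lambda>b. (SOME D. (b, D) \<in> X) k) = m k (oth1 k)" if j12: "j \<in> {1,2}" and k: "k \<in> {1,2,3}" for k
  proof (rule message_of_eq[OF k])
    show "m k (oth1 k) \<in> {1..Mz k}"
      using m k by (auto simp: valid_messages_def)
    fix b assume b: "b < B"
    have "down_test g j (\<lambda>t. restrict (ypast h1 h2 h3 (code g) m z n j) {..<n} ((b + 1) * N + t)) D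
      = down_test \<omega> j (down_received \<omega> j (digits m b) b) D" for D
      unfolding down unfolding down_test_def
    proof (rule plausible_cong)
      fix t assume t: "t < N"
      show "restrict (ypast h1 h2 h3 (code g) m z n j) {..<n} ((b + 1) * N + t) = down_received \<omega> j (digits m b) b t"
        using Yj[OF b t] block_le(2)[OF b t] by simp
    qed simp
    moreover have "down_ok \<omega> j (digits m b) b"
      using ok[OF b] j12 by (auto simp: block_ok_def)
    ultimately have "(b, D) \<in> X \<longleftrightarrow> D = digits m b" for D
      using digits_Cand[OF m b] b dg[OF j] by (auto simp: X_def down_ok_def)
    then show "(SOME D. (b, D) \<in> X) k = \<phi> k (m k (oth1 k)) b"
      by (simp add: dg[OF k])
  qed
  show ?thesis
    unfolding dec decoded_def Let_def
    using est[of 1] est[of 2] est[of 3] m j by (auto simp: oth1_def oth2_def valid_messages_def)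
qed

section \<open>The joint probability space of codebook and noise\<close>

definition relay_or_user_messages :: "nat \<Rightarrow> nat set" where
  "relay_or_user_messages j = (if j = 0 then relay_message ` Cand else {..<L j})"

text \<open>Only codewords that some candidate can call for; this keeps the index set finite, as
  integrating out the codebook and the noise separately requires.\<close>

definition IC :: "(nat \<times> nat) set" where
  "IC = (\<lambda>(j, m, t). \<kappa> j m t) ` (SIGMA j:{0,1,2,3}. relay_or_user_messages j \<times> {..<N})"

definition IZ :: "(nat \<times> nat) set" where
  "IZ = {..<4} \<times> {..<n}"

abbreviation \<Omega> :: "(nat \<times> nat \<Rightarrow> real) measure" where
  "\<Omega> \<equiv> PiM (IC \<union> IZ) (\<lambda>_. std_normal)"

lemma finite_IC: "finite IC"
  unfolding IC_def using finite_Cand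
  by (intro finite_imageI finite_SigmaI) (auto simp: relay_or_user_messages_def)

lemma finite_IZ: "finite IZ"
  by (simp add: IZ_def)

lemma IC_IZ: "IC \<inter> IZ = {}"
  by (auto simp: IC_def IZ_def codeword_index_def)

lemma IC_I: "j \<in> {0,1,2,3} \<Longrightarrow> m \<in> relay_or_user_messages j \<Longrightarrow> t < N \<Longrightarrow> \<kappa> j m t \<in> IC"
  unfolding IC_def by force

sublocale prob_space \<Omega>
  by (rule prob_space_PiM_std_normal)

lemma gaussian_block_up:
  assumes b: "b < B"
  shows "gaussian_block (IC \<union> IZ) \<kappa> (\<lambda>t. (0, b * N + t)) N {1,2,3} relay_or_user_messages (\<lambda>j. hh j * sqrt q)"
proof
  show "(0, b * N + t) \<in> IC \<union> IZ" if "t < N" for t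
    using block_le(1)[OF b that] by (simp add: IZ_def)
qed (use N_pos q_pos hh_nz IC_I in \<open>auto simp: codeword_index_def\<close>)

lemma gaussian_block_down:
  assumes b: "b < B" and j: "j \<in> {1,2}"
  shows "gaussian_block (IC \<union> IZ) \<kappa> (\<lambda>t. (j, (b + 1) * N + t)) N {0} relay_or_user_messages (\<lambda>_. hh j * sqrt q)"
proof
  show "(j, (b + 1) * N + t) \<in> IC \<union> IZ" if "t < N" for t
    using block_le(2)[OF b that] j by (auto simp: IZ_def)
qed (use N_pos q_pos hh_nz IC_I j in \<open>auto simp: codeword_index_def\<close>)

text \<open>A candidate that agrees with \<open>D\<close> outside \<open>S\<close> is determined by
  its restriction to \<open>S\<close>.\<close>

lemma card_agreeing_candidates:
  assumes S: "S \<subseteq> {1,2,3}"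
  shows "card {D' \<in> Cand. \<forall>j\<in>{1,2,3} - S. D' j = D j} \<le> (\<Prod>j\<in>S. L j)"
proof -
  have finS: "finite S" using S by (auto dest: finite_subset)
  have "card {D' \<in> Cand. \<forall>j\<in>{1,2,3} - S. D' j = D j} \<le> card (PiE S (\<lambda>j. {..<L j}))"
  proof (rule card_inj_on_le)
    show "inj_on (\<lambda>D'. restrict D' S) {D' \<in> Cand. \<forall>j\<in>{1,2,3} - S. D' j = D j}"
    proof (rule inj_onI)
      fix x y assume x: "x \<in> {D' \<in> Cand. \<forall>j\<in>{1,2,3} - S. D' j = D j}" and y: "y \<in> {D' \<in> Cand. \<forall>j\<in>{1,2,3} - S. D' j = D j}"
        and eq: "restrict x S = restrict y S"
      show "x = y"
      proof (rule PiE_ext)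
        show "x \<in> PiE {1,2,3} (\<lambda>j. {..<L j})" "y \<in> PiE {1,2,3} (\<lambda>j. {..<L j})"
          using x y by (auto simp: Cand_def)
        fix j :: nat assume "j \<in> {1,2,3}"
        then show "x j = y j"
          using x y fun_cong[OF eq, of j] by (cases "j \<in> S") auto
      qed
    qed
    show "(\<lambda>D'. restrict D' S) ` {D' \<in> Cand. \<forall>j\<in>{1,2,3} - S. D' j = D j} \<subseteq> PiE S (\<lambda>j. {..<L j})"
    proof clarify
      fix D' assume "D' \<in> Cand"
      then show "restrict D' S \<in> PiE S (\<lambda>j. {..<L j})"
        using S unfolding Cand_def by (intro restrict_PiE_iff[THEN iffD2]) (auto simp: PiE_iff)
    qed
  qed (use finS in \<open>auto intro: finite_PiE\<close>)
  also have "\<dots> = (\<Prod>j\<in>S. L j)"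
    using finS by (simp add: card_PiE)
  finally show ?thesis .
qed

text \<open>The number of competitors, about 2 to the power N times their total rate, against the
  confusion probability of each: the rate condition leaves at most \<beta> per letter. The constant
  is 2 ^ 3, a factor 2 for rounding each of at most three digit alphabets.\<close>

lemma candidates_bound:
  assumes S: "S \<subseteq> {1,2,3}" and s: "0 < s" and rate: "2 powr (\<Sum>j\<in>S. \<rho> j) * exp e \<le> \<beta> * s"
  shows "real (\<Prod>j\<in>S. L j) * (exp e / s) ^ N \<le> 8 * \<beta> ^ N"
proof -
  have finS: "finite S" and cS: "card S \<le> 3"
    using S card_mono[of "{1,2,3}" S] by (auto dest: finite_subset)
  have "real (\<Prod>j\<in>S. L j) \<le> (\<Prod>j\<in>S. 2 * 2 powr (real N * \<rho> j))"
    unfolding of_nat_prod using S L_le by (intro prod_mono) auto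
  also have "\<dots> = 2 ^ card S * (2 powr (\<Sum>j\<in>S. \<rho> j)) ^ N"
    using finS by (simp add: prod.distrib powr_sum[symmetric] powr_power sum_distrib_left mult.commute)
  also have "\<dots> \<le> 8 * (2 powr (\<Sum>j\<in>S. \<rho> j)) ^ N"
    using power_increasing[OF cS, of "2::real"] by (intro mult_right_mono) auto
  finally have "real (\<Prod>j\<in>S. L j) * (exp e / s) ^ N \<le> 8 * (2 powr (\<Sum>j\<in>S. \<rho> j)) ^ N * (exp e / s) ^ N"
    using s by (intro mult_right_mono) auto
  also have "\<dots> = 8 * (2 powr (\<Sum>j\<in>S. \<rho> j) * exp e / s) ^ N"
    by (simp add: power_mult_distrib[symmetric])
  also have "\<dots> \<le> 8 * \<beta> ^ N"
    using rate s by (intro mult_left_mono power_mono) (auto simp: field_simps)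
  finally show ?thesis .
qed

text \<open>Wrong candidates are grouped by the set \<open>S\<close> of users whose digit is wrong.
  Each of the 7 nonempty sets contributes at most \<open>8 * \<beta> ^ N\<close>, hence 56; the 16
  is 2 ^ 3 subset checks times the 2 from Chebyshev's inequality.\<close>

lemma up_error:
  assumes b: "b < B" and D: "D \<in> Cand"
  shows "{\<omega> \<in> space \<Omega>. \<not> up_ok \<omega> D b} \<in> events"
    and "prob {\<omega> \<in> space \<Omega>. \<not> up_ok \<omega> D b} \<le> 16 / (e\<^sup>2 * real N) + 56 * \<beta> ^ N"
proof -
  interpret U: gaussian_block "IC \<union> IZ" \<kappa> "\<lambda>t. (0, b * N + t)" N "{1,2,3}" relay_or_user_messages "\<lambda>j. hh j * sqrt q"
    by (rule gaussian_block_up[OF b])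
  have rec: "U.received D \<omega> = up_received \<omega> D b" for \<omega>
    by (rule ext) (simp only: U.received_def up_received_def)
  have mem: "D' j \<in> relay_or_user_messages j" if "D' \<in> Cand" "j \<in> {1,2,3}" for D' j
    using that by (auto simp: Cand_def relay_or_user_messages_def PiE_iff)
  have differ: "{j \<in> {1,2,3}. D' j \<noteq> D j} \<noteq> {}" if "D' \<in> Cand" "D' \<noteq> D" for D'
    using that D PiE_ext[of D' "{1,2,3}" "\<lambda>j. {..<L j}" D] unfolding Cand_def by blast
  note err = U.decoding_error[where f="\<lambda>D. D", OF finite_Cand D _ _ e_pos, unfolded rec, folded up_test_def, folded up_ok_def]
  show "{\<omega> \<in> space \<Omega>. \<not> up_ok \<omega> D b} \<in> events"
    by (rule err(1)) (erule mem, assumption, erule differ, assumption)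
  have err2: "prob {\<omega> \<in> space \<Omega>. \<not> up_ok \<omega> D b} \<le> 2 ^ card {1,2,3::nat} * (2 / (e\<^sup>2 * real N))
      + (\<Sum>D'\<in>Cand - {D}. (exp e / sqrt (1 + U.Pw {j \<in> {1,2,3}. D' j \<noteq> D j})) ^ N)"
    by (rule err(2)) (erule mem, assumption, erule differ, assumption)
  define f where "f S = (exp e / sqrt (1 + U.Pw S)) ^ N" for S
  have f0: "0 \<le> f S" for S
    using U.Pw_nonneg[of S] by (simp add: f_def)
  have "(\<Sum>D'\<in>Cand - {D}. f {j \<in> {1,2,3}. D' j \<noteq> D j})
     = (\<Sum>S\<in>Pow {1,2,3} - {{}}. \<Sum>D'\<in>{D' \<in> Cand - {D}. {j \<in> {1,2,3}. D' j \<noteq> D j} = S}. f {j \<in> {1,2,3}. D' j \<noteq> D j})"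
    using finite_Cand differ by (intro sum.group[symmetric]) auto
  also have "\<dots> \<le> (\<Sum>S\<in>Pow {1,2,3} - {{}::nat set}. 8 * \<beta> ^ N)"
  proof (rule sum_mono)
    fix S :: "nat set" assume "S \<in> Pow {1,2,3} - {{}}"
    then have S: "S \<subseteq> {1,2,3}" "S \<noteq> {}" by auto
    have "(\<Sum>D'\<in>{D' \<in> Cand - {D}. {j \<in> {1,2,3}. D' j \<noteq> D j} = S}. f {j \<in> {1,2,3}. D' j \<noteq> D j})
       = real (card {D' \<in> Cand - {D}. {j \<in> {1,2,3}. D' j \<noteq> D j} = S}) * f S"
      by simp
    also have "\<dots> \<le> real (card {D' \<in> Cand. \<forall>j\<in>{1,2,3} - S. D' j = D j}) * f S"
      using f0 finite_Cand by (intro mult_right_mono of_nat_mono card_mono) auto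
    also have "\<dots> \<le> real (\<Prod>j\<in>S. L j) * f S"
      using f0 card_agreeing_candidates[OF S(1)] by (intro mult_right_mono of_nat_mono)
    also have "\<dots> \<le> 8 * \<beta> ^ N"
      unfolding f_def using uplink[OF S] q_pos U.Pw_nonneg[of S]
      by (intro candidates_bound[OF S(1)]) (auto simp: U.Pw_def power_mult_distrib)
    finally show "(\<Sum>D'\<in>{D' \<in> Cand - {D}. {j \<in> {1,2,3}. D' j \<noteq> D j} = S}. f {j \<in> {1,2,3}. D' j \<noteq> D j}) \<le> 8 * \<beta> ^ N" .
  qed
  also have "\<dots> = 56 * \<beta> ^ N"
    by (simp add: card_Pow)
  finally show "prob {\<omega> \<in> space \<Omega>. \<not> up_ok \<omega> D b} \<le> 16 / (e\<^sup>2 * real N) + 56 * \<beta> ^ N"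
    using err2 by (simp add: f_def)
qed

text \<open>User \<open>j\<close> knows its own digit, so only the digits of its two partners are
  open, and every wrong candidate means a wrong relay codeword. There is a single transmitter here,
  whence the constant 2 ^ 1 * 2.\<close>

lemma down_error:
  assumes b: "b < B" and D: "D \<in> Cand" and j: "j \<in> {1,2}"
  shows "{\<omega> \<in> space \<Omega>. \<not> down_ok \<omega> j D b} \<in> events"
    and "prob {\<omega> \<in> space \<Omega>. \<not> down_ok \<omega> j D b} \<le> 4 / (e\<^sup>2 * real N) + 8 * \<beta> ^ N"
proof -
  interpret U: gaussian_block "IC \<union> IZ" \<kappa> "\<lambda>t. (j, (b + 1) * N + t)" N "{0}" relay_or_user_messages "\<lambda>_. hh j * sqrt q"
    by (rule gaussian_block_down[OF b j])
  define Ca where "Ca = {D' \<in> Cand. D' j = D j}"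
  have fin: "finite Ca" and D_Ca: "D \<in> Ca"
    using finite_Cand D by (auto simp: Ca_def)
  have rec: "U.received (\<lambda>_. relay_message D) \<omega> = down_received \<omega> j D b" for \<omega>
    unfolding U.received_def down_received_def by (rule ext) simp
  have mem: "relay_message D' \<in> relay_or_user_messages k" if "D' \<in> Ca" "k \<in> {0}" for D' k
    using that by (auto simp: Ca_def relay_or_user_messages_def)
  have neq: "relay_message D' \<noteq> relay_message D" if "D' \<in> Ca" "D' \<noteq> D" for D'
    using that D PiE_ext[of D' "{1,2,3}" "\<lambda>j. {..<L j}" D] unfolding Ca_def Cand_def relay_message_eq by blast
  then have differ: "{k \<in> {0::nat}. relay_message D' \<noteq> relay_message D} \<noteq> {}" if "D' \<in> Ca" "D' \<noteq> D" for D'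
    using that by blast
  note err = U.decoding_error[where f="\<lambda>D _. relay_message D", OF fin D_Ca mem differ e_pos, unfolded rec,
      folded down_test_def, unfolded Ca_def, folded down_ok_def, folded Ca_def]
  show "{\<omega> \<in> space \<Omega>. \<not> down_ok \<omega> j D b} \<in> events"
    using err(1) by simp
  define s where "s = sqrt (1 + (hh j)\<^sup>2 * q)"
  have s: "0 < s"
    unfolding s_def using q_pos by (simp add: add_pos_nonneg)
  have "(\<Sum>D'\<in>Ca - {D}. (exp e / sqrt (1 + U.Pw {k \<in> {0}. relay_message D' \<noteq> relay_message D})) ^ N)
      = (\<Sum>D'\<in>Ca - {D}. (exp e / s) ^ N)"
    using neq q_pos by (intro sum.cong) (auto simp: U.Pw_def s_def power_mult_distrib)
  also have "\<dots> = real (card (Ca - {D})) * (exp e / s) ^ N"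
    by simp
  also have "\<dots> \<le> real (card {D' \<in> Cand. \<forall>k\<in>{1,2,3} - ({1,2,3} - {j}). D' k = D k}) * (exp e / s) ^ N"
    using s finite_Cand j by (intro mult_right_mono of_nat_mono card_mono) (auto simp: Ca_def)
  also have "\<dots> \<le> real (\<Prod>k\<in>{1,2,3} - {j}. L k) * (exp e / s) ^ N"
    using s card_agreeing_candidates[of "{1,2,3} - {j}" D] by (intro mult_right_mono of_nat_mono) auto
  also have "\<dots> \<le> 8 * \<beta> ^ N"
    using downlink[OF j] s by (intro candidates_bound) (auto simp: s_def)
  finally show "prob {\<omega> \<in> space \<Omega>. \<not> down_ok \<omega> j D b} \<le> 4 / (e\<^sup>2 * real N) + 8 * \<beta> ^ N"
    using err(2) by simp
qed

text \<open>The margin \<open>q * (1 + e) \<le> P\<close> means that a silenced codeword has energy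
  exceeding its mean by a relative amount of at least \<open>e\<close>.\<close>

lemma energy_error:
  assumes j: "j \<in> {0,1,2,3}" and m: "m \<in> relay_or_user_messages j"
  shows "{\<omega> \<in> space \<Omega>. \<not> low_energy \<omega> j m} \<in> events"
    and "prob {\<omega> \<in> space \<Omega>. \<not> low_energy \<omega> j m} \<le> 2 / (e\<^sup>2 * real N)"
proof -
  have I: "\<kappa> j m t \<in> IC \<union> IZ" if "t < N" for t
    using IC_I[OF j m that] by simp
  have [measurable]: "(\<lambda>\<omega>. \<omega> (\<kappa> j m t)) \<in> borel_measurable \<Omega>" if "t < N" for t
    using measurable_component_singleton[OF I[OF that], of "\<lambda>_. std_normal"] by simp
  show "{\<omega> \<in> space \<Omega>. \<not> low_energy \<omega> j m} \<in> events"
    unfolding low_energy_def by measurable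
  note L = PiM_std_normal_linear_combinations[where T="{..<N}" and K="\<lambda>t. {\<kappa> j m t}" and c="\<lambda>_ _. 1" and I="IC \<union> IZ"]
  have "indep_vars (\<lambda>_. borel) (\<lambda>t \<omega>. \<omega> (\<kappa> j m t)) {..<N}"
    using L(1) I N_pos by (auto simp: disjoint_family_on_def codeword_index_def)
  moreover have "distributed \<Omega> lborel (\<lambda>\<omega>. \<omega> (\<kappa> j m t)) (\<lambda>x. ennreal (std_normal_density x))" if "t < N" for t
    using L(2)[of t] I N_pos that by (auto simp: disjoint_family_on_def codeword_index_def)
  ultimately have dev: "prob {\<omega> \<in> space \<Omega>. \<bar>(\<Sum>t\<in>{..<N}. (\<omega> (\<kappa> j m t))\<^sup>2) - real (card {..<N})\<bar> \<ge> e * real (card {..<N})}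
     \<le> 2 / (e\<^sup>2 * real (card {..<N}))"
    using N_pos e_pos by (intro indep_std_normal_sum_squares_deviation) auto
  have "prob {\<omega> \<in> space \<Omega>. \<not> low_energy \<omega> j m} \<le>
    prob {\<omega> \<in> space \<Omega>. \<bar>(\<Sum>t\<in>{..<N}. (\<omega> (\<kappa> j m t))\<^sup>2) - real (card {..<N})\<bar> \<ge> e * real (card {..<N})}"
  proof (rule finite_measure_mono)
    show "{\<omega> \<in> space \<Omega>. \<not> low_energy \<omega> j m} \<subseteq>
      {\<omega> \<in> space \<Omega>. \<bar>(\<Sum>t\<in>{..<N}. (\<omega> (\<kappa> j m t))\<^sup>2) - real (card {..<N})\<bar> \<ge> e * real (card {..<N})}"
    proof clarify
      fix \<omega> assume "\<not> low_energy \<omega> j m"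
      then have "real N * P < q * (\<Sum>t<N. (\<omega> (\<kappa> j m t))\<^sup>2)"
        using q_pos by (simp add: low_energy_def power_mult_distrib sum_distrib_left)
      moreover have "q * (real N * (1 + e)) \<le> real N * P"
        using mult_left_mono[OF q_P, of "real N"] by (simp add: algebra_simps)
      ultimately have "q * (real N * (1 + e)) < q * (\<Sum>t<N. (\<omega> (\<kappa> j m t))\<^sup>2)"
        by linarith
      then have "real N * (1 + e) < (\<Sum>t<N. (\<omega> (\<kappa> j m t))\<^sup>2)"
        using q_pos by simp
      then show "\<bar>(\<Sum>t\<in>{..<N}. (\<omega> (\<kappa> j m t))\<^sup>2) - real (card {..<N})\<bar> \<ge> e * real (card {..<N})"
        by (simp add: algebra_simps)
    qed
  qed measurable
  then show "prob {\<omega> \<in> space \<Omega>. \<not> low_energy \<omega> j m} \<le> 2 / (e\<^sup>2 * real N)"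
    using dev by simp
qed

lemma block_error:
  assumes b: "b < B" and D: "D \<in> Cand"
  shows "{\<omega> \<in> space \<Omega>. \<not> block_ok \<omega> D b} \<in> events"
    and "prob {\<omega> \<in> space \<Omega>. \<not> block_ok \<omega> D b} \<le> 32 / (e\<^sup>2 * real N) + 72 * \<beta> ^ N"
proof -
  \<comment> \<open>Seven events: the energies of the relay and the three users, the uplink, and the
    downlinks to users 1 and 2. The constants add up as 4 * 2 + 16 + 4 + 4 = 32 and 56 + 8 + 8 =
    72.\<close>
  define E where "E = (\<lambda>i::nat. if i = 0 then {\<omega> \<in> space \<Omega>. \<not> low_energy \<omega> 0 (relay_message D)}
     else if i < 4 then {\<omega> \<in> space \<Omega>. \<not> low_energy \<omega> i (D i)}
     else if i = 4 then {\<omega> \<in> space \<Omega>. \<not> up_ok \<omega> D b}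
     else {\<omega> \<in> space \<Omega>. \<not> down_ok \<omega> (i - 4) D b})"
  have mem: "relay_message D \<in> relay_or_user_messages 0" "D i \<in> relay_or_user_messages i" if "i \<in> {1,2,3}" for i
    using D that by (auto simp: relay_or_user_messages_def Cand_def PiE_iff)
  have EE: "{\<omega> \<in> space \<Omega>. \<not> block_ok \<omega> D b} = (\<Union>i\<in>{0,1,2,3,4,5,6}. E i)"
    by (auto simp: E_def block_ok_def)
  have E_ev: "E i \<in> events" if "i \<in> {0,1,2,3,4,5,6}" for i
    using that energy_error(1)[of 0 "relay_message D"] energy_error(1)[of i "D i"] mem[of i] mem(1)[of 1] up_error(1)[OF b D]
      down_error(1)[OF b D, of "i - 4"] by (auto simp: E_def)
  show "{\<omega> \<in> space \<Omega>. \<not> block_ok \<omega> D b} \<in> events"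
    unfolding EE using E_ev by blast
  have "prob {\<omega> \<in> space \<Omega>. \<not> block_ok \<omega> D b} \<le> (\<Sum>i\<in>{0,1,2,3,4,5,6}. prob (E i))"
    unfolding EE using E_ev by (intro finite_measure_subadditive_finite) auto
  also have "\<dots> = prob (E 0) + prob (E 1) + prob (E 2) + prob (E 3) + prob (E 4) + prob (E 5) + prob (E 6)"
    by simp
  also have "\<dots> \<le> 2 / (e\<^sup>2 * real N) + 2 / (e\<^sup>2 * real N) + 2 / (e\<^sup>2 * real N) + 2 / (e\<^sup>2 * real N)
      + (16 / (e\<^sup>2 * real N) + 56 * \<beta> ^ N) + (4 / (e\<^sup>2 * real N) + 8 * \<beta> ^ N) + (4 / (e\<^sup>2 * real N) + 8 * \<beta> ^ N)"
    using energy_error(2)[of 0 "relay_message D"] energy_error(2)[of _ "D _"] mem mem(1)[of 1] up_error(2)[OF b D]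
      down_error(2)[OF b D]
    by (intro add_mono) (auto simp: E_def)
  also have "\<dots> = 32 / (e\<^sup>2 * real N) + 72 * \<beta> ^ N"
    by (simp add: add_divide_distrib[symmetric])
  finally show "prob {\<omega> \<in> space \<Omega>. \<not> block_ok \<omega> D b} \<le> 32 / (e\<^sup>2 * real N) + 72 * \<beta> ^ N" .
qed

end

section \<open>From the random codebook to a fixed one\<close>

context decode_forward
begin

text \<open>Integrating first over the noise and then over the codebook shows that the error
  averaged over codebooks and messages is at most half the stated bound, so not every codebook can
  exceed that bound.\<close>

lemma exists_codebook:
  assumes fin: "finite (msgs n R)" and ne: "msgs n R \<noteq> {}" and B: "0 < B"
    and valid: "\<And>m. m \<in> msgs n R \<Longrightarrow> valid_messages m"
  shows "\<exists>g. perr h1 h2 h3 n R (code g) \<le> 2 * (real B * (32 / (e\<^sup>2 * real N) + 72 * \<beta> ^ N))"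
proof -
  define \<eta> where "\<eta> = real B * (32 / (e\<^sup>2 * real N) + 72 * \<beta> ^ N)"
  have \<eta>: "0 < \<eta>"
    unfolding \<eta>_def using B e_pos N_pos \<beta>_nonneg
    by (intro mult_pos_pos add_pos_nonneg divide_pos_pos) auto
  define c where "c = real (card (msgs n R))"
  have c: "0 < c" using fin ne by (simp add: c_def card_gt_0_iff)
  interpret S: product_sigma_finite "\<lambda>_. std_normal"
    by (intro product_sigma_finite.intro prob_space_imp_sigma_finite prob_space_std_normal)
  interpret C: prob_space "PiM IC (\<lambda>_. std_normal)"
    by (rule prob_space_PiM_std_normal)
  have noise: "noise n = PiM IZ (\<lambda>_. std_normal)"
    by (simp add: noise_def IZ_def)
  interpret Z: prob_space "noise n"
    unfolding noise by (rule prob_space_PiM_std_normal)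
  define Bad where "Bad m = (\<Union>b<B. {\<omega> \<in> space \<Omega>. \<not> block_ok \<omega> (digits m b) b})" for m
  have Bad_ev: "Bad m \<in> events" if "m \<in> msgs n R" for m
    unfolding Bad_def using block_error(1) digits_Cand[OF valid[OF that]] by auto
  have Bad_le: "prob (Bad m) \<le> \<eta>" if "m \<in> msgs n R" for m
  proof -
    have "prob (Bad m) \<le> (\<Sum>b<B. prob {\<omega> \<in> space \<Omega>. \<not> block_ok \<omega> (digits m b) b})"
      unfolding Bad_def using block_error(1) digits_Cand[OF valid[OF that]]
      by (intro finite_measure_subadditive_finite) auto
    also have "\<dots> \<le> (\<Sum>b<B. 32 / (e\<^sup>2 * real N) + 72 * \<beta> ^ N)"
      using block_error(2) digits_Cand[OF valid[OF that]] by (intro sum_mono) auto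
    finally show ?thesis by (simp add: \<eta>_def)
  qed
  \<comment> \<open>The section of the bad event at the codebook \<open>g\<close>, a set of noise
    realizations.\<close>
  define F where "F m g = (\<lambda>z. merge IC IZ (g, z)) -` Bad m \<inter> space (noise n)" for m g
  have F_int: "emeasure \<Omega> (Bad m) = (\<integral>\<^sup>+g. emeasure (noise n) (F m g) \<partial>PiM IC (\<lambda>_. std_normal))"
    and F_meas: "(\<lambda>g. emeasure (noise n) (F m g)) \<in> borel_measurable (PiM IC (\<lambda>_. std_normal))" if "m \<in> msgs n R" for m
    unfolding F_def noise using S.emeasure_fold_integral[OF IC_IZ finite_IC finite_IZ Bad_ev[OF that]]
      S.emeasure_fold_measurable[OF IC_IZ finite_IC finite_IZ Bad_ev[OF that]] by auto
  \<comment> \<open>The factor 2 lets a non-strict comparison of integrals yield a contradiction,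
    because \<open>\<eta>\<close> is positive.\<close>
  have "\<exists>g\<in>space (PiM IC (\<lambda>_. std_normal)). (\<Sum>m\<in>msgs n R. emeasure (noise n) (F m g)) \<le> ennreal (c * (2 * \<eta>))"
  proof (rule ccontr)
    assume "\<not> ?thesis"
    then have "ennreal (c * (2 * \<eta>)) \<le> (\<Sum>m\<in>msgs n R. emeasure (noise n) (F m g))"
      if "g \<in> space (PiM IC (\<lambda>_. std_normal))" for g
      using that by (meson not_le less_imp_le)
    then have "(\<integral>\<^sup>+g. ennreal (c * (2 * \<eta>)) \<partial>PiM IC (\<lambda>_. std_normal))
        \<le> (\<integral>\<^sup>+g. (\<Sum>m\<in>msgs n R. emeasure (noise n) (F m g)) \<partial>PiM IC (\<lambda>_. std_normal))"
      by (intro nn_integral_mono)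
    also have "\<dots> = (\<Sum>m\<in>msgs n R. emeasure \<Omega> (Bad m))"
      using F_meas F_int by (subst nn_integral_sum) auto
    also have "\<dots> \<le> (\<Sum>m\<in>msgs n R. ennreal \<eta>)"
      using Bad_le by (intro sum_mono) (simp add: emeasure_eq_measure ennreal_leI)
    also have "\<dots> = ennreal (c * \<eta>)"
      using \<eta> by (simp add: c_def ennreal_of_nat_eq_real_of_nat ennreal_mult'[symmetric])
    finally have "ennreal (c * (2 * \<eta>)) \<le> ennreal (c * \<eta>)"
      by (simp add: C.emeasure_space_1)
    then show False
      using c \<eta> by (simp add: ennreal_le_iff)
  qed
  then obtain g where g: "g \<in> space (PiM IC (\<lambda>_. std_normal))"
    and g_le: "(\<Sum>m\<in>msgs n R. emeasure (noise n) (F m g)) \<le> ennreal (c * (2 * \<eta>))" by blast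
  have F_sets: "F m g \<in> sets (noise n)" if "m \<in> msgs n R" for m
  proof -
    have "(\<lambda>z. merge IC IZ (g, z)) \<in> measurable (PiM IZ (\<lambda>_. std_normal)) \<Omega>"
      using measurable_compose[OF measurable_Pair1'[OF g] measurable_merge] by simp
    from measurable_sets[OF this Bad_ev[OF that]] show ?thesis
      by (simp add: F_def noise)
  qed
  have sub: "err_event h1 h2 h3 n (code g) m \<subseteq> F m g" if m: "m \<in> msgs n R" for m
  proof (rule subsetI, rule ccontr)
    fix z assume z: "z \<in> err_event h1 h2 h3 n (code g) m" and nz: "z \<notin> F m g"
    define \<omega> where "\<omega> = merge IC IZ (g, z)"
    have zs: "z \<in> space (PiM IZ (\<lambda>_. std_normal))"
      using z by (simp add: err_event_def noise)
    have \<omega>s: "\<omega> \<in> space \<Omega>"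
      using g zs unfolding \<omega>_def space_PiM by auto
    have ok: "block_ok \<omega> (digits m b) b" if "b < B" for b
      using nz zs \<omega>s that by (auto simp: F_def Bad_def noise \<omega>_def)
    \<comment> \<open>Codeword coordinates outside \<open>IC\<close> must agree too; there both
      \<open>g\<close> and the merged point are \<open>undefined\<close>.\<close>
    have "\<omega> (\<kappa> j k t) = g (\<kappa> j k t)" for j k t
    proof -
      have "\<kappa> j k t \<notin> IZ" by (simp add: IZ_def codeword_index_def)
      moreover have "g (\<kappa> j k t) = undefined" if "\<kappa> j k t \<notin> IC"
        using PiE_arb[OF g[unfolded space_PiM] that] .
      ultimately show ?thesis by (auto simp: \<omega>_def merge_def)
    qed
    moreover have "\<omega> (a, t) = z (a, t)" if "a < 4" "t < n" for a t
    proof -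
      have "(a, t) \<in> IZ" using that by (simp add: IZ_def)
      then show ?thesis using IC_IZ by (auto simp: \<omega>_def merge_def)
    qed
    ultimately show False
      using z correct_decoding[OF valid[OF m] ok] unfolding err_event_def by blast
  qed
  have "ennreal (\<Sum>m\<in>msgs n R. measure (noise n) (err_event h1 h2 h3 n (code g) m))
    = (\<Sum>m\<in>msgs n R. emeasure (noise n) (err_event h1 h2 h3 n (code g) m))"
    by (subst sum_ennreal[symmetric]) (auto simp: Z.emeasure_eq_measure)
  also have "\<dots> \<le> (\<Sum>m\<in>msgs n R. emeasure (noise n) (F m g))"
    using sub F_sets by (intro sum_mono emeasure_mono) auto
  also note g_le
  finally have "(\<Sum>m\<in>msgs n R. measure (noise n) (err_event h1 h2 h3 n (code g) m)) \<le> c * (2 * \<eta>)"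
    using c \<eta> by (subst (asm) ennreal_le_iff) auto
  then have "perr h1 h2 h3 n R (code g) \<le> 2 * \<eta>"
    using c by (simp add: perr_def c_def[symmetric] field_simps)
  then show ?thesis
    unfolding \<eta>_def by blast
qed

end

section \<open>Achievable rates\<close>

text \<open>Every decoder recovers the messages of all users, so only the total rate of each user matters and
  each user may put all of it into one message: 1 to 2, 2 to 1 and 3 to 1. User 3 then has nothing to decode.\<close>

definition three_rates :: "(nat \<Rightarrow> real) \<Rightarrow> nat \<Rightarrow> nat \<Rightarrow> real" where
  "three_rates r j k = (if k = oth1 j then r j else 0)"

section \<open>Message sets and the rate-zero code\<close>

lemma user_pairs_eq: "user_pairs = {(1,2),(1,3),(2,1),(2,3),(3,1),(3,2)}"
  by (auto simp: user_pairs_def)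

lemma sum_three_rates: "(\<Sum>(j, k)\<in>user_pairs. three_rates r j k) = r 1 + r 2 + r 3"
  by (simp add: user_pairs_eq three_rates_def oth1_def)

lemma msize_0: "msize n 0 = 1"
  by (simp add: msize_def)

lemma msize_pos: "0 < msize n r"
  by (simp add: msize_def)

lemma msgs_range:
  assumes "m \<in> msgs n R" "(j, k) \<in> user_pairs"
  shows "m j k \<in> {1..msize n (R j k)}"
proof -
  have "if (j, k) \<in> user_pairs then m j k \<in> {1..msize n (R j k)} else m j k = 0"
    using assms(1) unfolding msgs_def by blast
  with assms(2) show ?thesis by simp
qed

lemma finite_msgs: "finite (msgs n R)"
proof (rule finite_subset)
  show "msgs n R \<subseteq> (\<lambda>f j k. if (j, k) \<in> user_pairs then f (j, k) else 0) ` (PiE user_pairs (\<lambda>(j, k). {1..msize n (R j k)}))"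
  proof
    fix m assume m: "m \<in> msgs n R"
    show "m \<in> (\<lambda>f j k. if (j, k) \<in> user_pairs then f (j, k) else 0) ` (PiE user_pairs (\<lambda>(j, k). {1..msize n (R j k)}))"
    proof (rule image_eqI)
      show "m = (\<lambda>j k. if (j, k) \<in> user_pairs then restrict (\<lambda>(j, k). m j k) user_pairs (j, k) else 0)"
        using m by (auto simp: msgs_def fun_eq_iff split: if_splits)
      show "restrict (\<lambda>(j, k). m j k) user_pairs \<in> PiE user_pairs (\<lambda>(j, k). {1..msize n (R j k)})"
        unfolding restrict_PiE_iff using msgs_range[OF m] by auto
    qed
  qed
  show "finite ((\<lambda>f j k. if (j, k) \<in> user_pairs then f (j, k) else 0) ` (PiE user_pairs (\<lambda>(j, k). {1..msize n (R j k)})))"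
    by (intro finite_imageI finite_PiE) (auto simp: user_pairs_eq)
qed

lemma msgs_nonempty: "msgs n R \<noteq> {}"
proof -
  have "(\<lambda>j k. if (j, k) \<in> user_pairs then 1 else 0) \<in> msgs n R"
    using msize_pos by (auto simp: msgs_def Suc_le_eq)
  then show ?thesis by blast
qed

text \<open>Serves as the code for block lengths at which the construction does not apply, and
  attains rate zero: every message then has the single value 1.\<close>

definition silent_code :: ycode where
  "silent_code = \<lparr> enc = (\<lambda>_ _ _ _ _. 0), rel = (\<lambda>_ _. 0), dec = (\<lambda>_ _ _ _. (1, 1)) \<rparr>"

lemma silent_code_measurable: "code_measurable n silent_code"
  by (simp add: code_measurable_def silent_code_def)

lemma silent_code_power: "power_ok h1 h2 h3 P n R silent_code"
  by (simp add: power_ok_def silent_code_def xsym_def)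

lemma achievable_zero: "achievable h1 h2 h3 P (\<lambda>_ _. 0)"
proof -
  have "perr h1 h2 h3 n (\<lambda>_ _. 0) silent_code = 0" for n
  proof -
    have "err_event h1 h2 h3 n silent_code m = {}" if "m \<in> msgs n (\<lambda>_ _. 0)" for m
    proof -
      have "m j k = 1" if "(j, k) \<in> user_pairs" for j k
      proof -
        have "m j k \<in> {1..msize n 0}"
          by (rule msgs_range[OF \<open>m \<in> msgs n (\<lambda>_ _. 0)\<close> that])
        then show ?thesis by (simp add: msize_0)
      qed
      then show ?thesis
        by (auto simp: err_event_def silent_code_def user_pairs_eq oth1_def oth2_def)
    qed
    then show ?thesis by (simp add: perr_def)
  qed
  then show ?thesis
    unfolding achievable_def
    by (auto intro!: exI[of _ "\<lambda>_. silent_code"] silent_code_measurable silent_code_power)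
qed

section \<open>From strict rate constraints to codes of every block length\<close>

lemma finite_less_uniform:
  fixes f :: "'a \<Rightarrow> real"
  assumes "finite A" "\<And>x. x \<in> A \<Longrightarrow> f x < 1"
  obtains c where "0 < c" "c < 1" "\<And>x. x \<in> A \<Longrightarrow> f x \<le> c"
proof
  \<comment> \<open>The element 1/2 keeps the maximum positive, and defined if \<open>A\<close> is
    empty.\<close>
  let ?M = "insert (1/2) (f ` A)"
  have fin: "finite ?M" "?M \<noteq> {}" using assms by auto
  show "0 < Max ?M" using Max_ge[OF fin(1), of "1/2"] by simp
  show "Max ?M < 1" using assms fin by (simp add: Max_less_iff)
  show "f x \<le> Max ?M" if "x \<in> A" for x using Max_ge[OF fin(1)] that by simp
qed

lemma powr_less_sqrt_of_less_Cf:
  assumes "x < Cf y" "0 \<le> y"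
  shows "2 powr x < sqrt (1 + y)"
proof -
  have "2 powr x < 2 powr (Cf y)"
    using assms by simp
  also have "2 powr (Cf y) = (2 powr (log 2 (1 + y))) powr (1/2)"
    by (simp add: Cf_def powr_powr)
  also have "\<dots> = sqrt (1 + y)"
    using assms by (simp add: powr_half_sqrt)
  finally show ?thesis .
qed

lemma exists_digits:
  fixes M L B :: nat
  assumes "M \<le> L ^ B"
  obtains \<phi> :: "nat \<Rightarrow> nat \<Rightarrow> nat" where "\<And>m b. m \<in> {1..M} \<Longrightarrow> b < B \<Longrightarrow> \<phi> m b < L"
    "\<And>m m'. m \<in> {1..M} \<Longrightarrow> m' \<in> {1..M} \<Longrightarrow> (\<And>b. b < B \<Longrightarrow> \<phi> m b = \<phi> m' b) \<Longrightarrow> m = m'"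
proof -
  have "card {1..M} \<le> card (PiE {..<B} (\<lambda>_. {..<L}))"
    using assms by (simp add: card_PiE)
  then obtain \<phi> where \<phi>: "\<phi> ` {1..M} \<subseteq> PiE {..<B} (\<lambda>_. {..<L})" "inj_on \<phi> {1..M}"
    using inj_on_iff_card_le[of "{1..M}" "PiE {..<B} (\<lambda>_. {..<L})"] by (auto intro: finite_PiE)
  show ?thesis
  proof
    show "\<phi> m b < L" if "m \<in> {1..M}" "b < B" for m b
      using PiE_mem[of "\<phi> m" "{..<B}" "\<lambda>_. {..<L}" b] \<phi>(1) that by blast
    show "m = m'" if "m \<in> {1..M}" "m' \<in> {1..M}" "\<And>b. b < B \<Longrightarrow> \<phi> m b = \<phi> m' b" for m m'
    proof (rule inj_onD[OF \<phi>(2) _ that(1,2)])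
      show "\<phi> m = \<phi> m'"
      proof (rule PiE_ext)
        show "\<phi> m \<in> PiE {..<B} (\<lambda>_. {..<L})" "\<phi> m' \<in> PiE {..<B} (\<lambda>_. {..<L})"
          using \<phi>(1) that by blast+
      qed (use that in simp)
    qed
  qed
qed

lemma filterlim_div_const: "filterlim (\<lambda>n. n div (B + 1)) sequentially (sequentially :: nat filter)"
  unfolding filterlim_at_top
proof
  fix Z :: nat
  show "\<forall>\<^sub>F n in sequentially. Z \<le> n div (B + 1)"
    using eventually_ge_at_top[of "Z * (B + 1)"]
    by eventually_elim (simp add: less_eq_div_iff_mult_less_eq)
qed

text \<open>Messages are sized for \<open>B + 1\<close> blocks of channel uses while only
  \<open>B\<close> of them carry fresh digits, since the relay lags by one block; hence
  \<open>\<rho>\<close> has to exceed \<open>r\<close> by more than the factor (B + 1)/B.\<close>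

lemma decode_forward_achievable:
  fixes h1 h2 h3 P q :: real and r \<rho> :: "nat \<Rightarrow> real" and B :: nat
  assumes h: "h1 \<noteq> 0" "h2 \<noteq> 0" "h3 \<noteq> 0" and q: "0 < q" "q < P" and B: "0 < B"
    and r: "\<And>j. j \<in> {1,2,3} \<Longrightarrow> 0 \<le> r j" and \<rho>: "\<And>j. j \<in> {1,2,3} \<Longrightarrow> real (B + 1) * r j < real B * \<rho> j"
    and up: "\<And>S. S \<subseteq> {1,2,3} \<Longrightarrow> S \<noteq> {} \<Longrightarrow> (\<Sum>j\<in>S. \<rho> j) < Cf (\<Sum>j\<in>S. (gain h1 h2 h3 j)\<^sup>2 * q)"
    and down: "\<And>j. j \<in> {1,2} \<Longrightarrow> (\<Sum>k\<in>{1,2,3} - {j}. \<rho> k) < Cf ((gain h1 h2 h3 j)\<^sup>2 * q)"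
  shows "achievable h1 h2 h3 P (three_rates r)"
proof -
  let ?h = "gain h1 h2 h3"
  have \<rho>0: "0 \<le> \<rho> j" if "j \<in> {1,2,3}" for j
  proof -
    have "0 \<le> real (B + 1) * r j" using r[OF that] by simp
    then have "0 < real B * \<rho> j" using \<rho>[OF that] by linarith
    then show ?thesis using B by (simp add: zero_less_mult_iff)
  qed
  obtain c1 where c1: "0 < c1" "c1 < 1"
    "\<And>S. S \<in> Pow {1,2,3} - {{}} \<Longrightarrow> 2 powr (\<Sum>j\<in>S. \<rho> j) / sqrt (1 + (\<Sum>j\<in>S. (?h j)\<^sup>2 * q)) \<le> c1"
  proof (rule finite_less_uniform)
    show "2 powr (\<Sum>j\<in>S. \<rho> j) / sqrt (1 + (\<Sum>j\<in>S. (?h j)\<^sup>2 * q)) < 1" if "S \<in> Pow {1,2,3} - {{}}" for S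
    proof -
      have n: "0 \<le> (\<Sum>j\<in>S. (?h j)\<^sup>2 * q)" using q by (intro sum_nonneg) auto
      then have s: "0 < sqrt (1 + (\<Sum>j\<in>S. (?h j)\<^sup>2 * q))" by simp
      from powr_less_sqrt_of_less_Cf[OF up n] that s show ?thesis by (subst divide_less_eq_1_pos) auto
    qed
  qed auto
  obtain c2 where c2: "0 < c2" "c2 < 1"
    "\<And>j. j \<in> {1,2} \<Longrightarrow> 2 powr (\<Sum>k\<in>{1,2,3} - {j}. \<rho> k) / sqrt (1 + (?h j)\<^sup>2 * q) \<le> c2"
  proof (rule finite_less_uniform)
    show "2 powr (\<Sum>k\<in>{1,2,3} - {j}. \<rho> k) / sqrt (1 + (?h j)\<^sup>2 * q) < 1" if "j \<in> {1,2}" for j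
    proof -
      have n: "0 \<le> (?h j)\<^sup>2 * q" using q by auto
      then have s: "0 < sqrt (1 + (?h j)\<^sup>2 * q)" by (simp add: add_pos_nonneg)
      from powr_less_sqrt_of_less_Cf[OF down[OF that] n] s show ?thesis by (subst divide_less_eq_1_pos) auto
    qed
  qed auto
  define c where "c = max c1 c2"
  \<comment> \<open>\<open>c < 1\<close> bounds all ratios of codebook growth to capacity, and
    \<open>\<beta>\<close> lies halfway between \<open>c\<close> and 1. The tolerance
    \<open>e\<close> must satisfy \<open>c * exp e \<le> \<beta>\<close>, its second bound, and
    \<open>q * (1 + e) \<le> P\<close>, its first.\<close>
  define \<beta> where "\<beta> = (1 + c) / 2"
  define e where "e = min (P / q - 1) (ln (\<beta> / c))"
  have c: "0 < c" "c < 1" "c1 \<le> c" "c2 \<le> c" using c1 c2 by (auto simp: c_def)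
  have \<beta>: "0 < \<beta>" "\<beta> < 1" "c < \<beta>" using c by (auto simp: \<beta>_def)
  have e: "0 < e" using q c \<beta> by (auto simp: e_def)
  have "exp e \<le> exp (ln (\<beta> / c))" by (simp add: e_def)
  then have ce: "c * exp e \<le> \<beta>" using c \<beta> by (simp add: field_simps)
  have "e \<le> P / q - 1" by (simp add: e_def)
  then have qe: "q * (1 + e) \<le> P" using q by (simp add: field_simps)
  have scale: "x * exp e \<le> \<beta> * s" if "x / s \<le> c" "0 < s" for x s
  proof -
    have "x * exp e \<le> (c * s) * exp e" using that by (intro mult_right_mono) (auto simp: field_simps)
    also have "\<dots> \<le> \<beta> * s" using ce that by (simp add: mult_right_mono mult.commute mult.left_commute)
    finally show ?thesis .
  qed
  define R where "R = three_rates r"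
  define NN where "NN n = n div (B + 1)" for n
  have NN_lim: "filterlim NN sequentially sequentially"
    unfolding NN_def[abs_def] by (rule filterlim_div_const)
  define \<eta> where "\<eta> N = 2 * (real B * (32 / (e\<^sup>2 * real N) + 72 * \<beta> ^ N))" for N
  have \<eta>_lim: "\<eta> \<longlonglongrightarrow> 0"
  proof -
    have a: "(\<lambda>N. 32 / e\<^sup>2 * (1 / real N)) \<longlonglongrightarrow> 32 / e\<^sup>2 * 0"
      by (intro tendsto_intros lim_1_over_n)
    have b: "(\<lambda>N. \<beta> ^ N) \<longlonglongrightarrow> 0"
      using \<beta> by (intro LIMSEQ_power_zero) auto
    have "(\<lambda>N. 2 * (real B * (32 / e\<^sup>2 * (1 / real N) + 72 * \<beta> ^ N))) \<longlonglongrightarrow> 2 * (real B * (32 / e\<^sup>2 * 0 + 72 * 0))"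
      by (rule tendsto_mult[OF tendsto_const tendsto_mult[OF tendsto_const tendsto_add[OF a tendsto_mult[OF tendsto_const b]]]])
    then show ?thesis by (simp add: \<eta>_def[abs_def])
  qed
  \<comment> \<open>With \<open>N = n div (B + 1)\<close> the true length \<open>n\<close> may
    exceed \<open>N * (B + 1)\<close> and is bounded by \<open>(N + 1) * (B + 1)\<close>; the strict
    gap between \<open>\<rho>\<close> and \<open>r\<close> absorbs this for large
    \<open>N\<close>.\<close>
  have large: "\<forall>\<^sub>F N in sequentially. 0 < N \<and> (\<forall>j\<in>{1,2,3}. real ((N + 1) * (B + 1)) * r j \<le> real (N * B) * \<rho> j)"
  proof -
    have "\<forall>\<^sub>F N in sequentially. real ((N + 1) * (B + 1)) * r j \<le> real (N * B) * \<rho> j" if "j \<in> {1,2,3}" for j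
    proof -
      define d where "d = real B * \<rho> j - real (B + 1) * r j"
      have d: "0 < d" using \<rho>[OF that] by (simp add: d_def)
      have "\<forall>\<^sub>F N in sequentially. real (B + 1) * r j / d \<le> real N"
        using filterlim_real_sequentially by (simp add: filterlim_at_top)
      then show ?thesis
      proof eventually_elim
        case (elim N)
        then have "real (B + 1) * r j \<le> real N * d" using d by (simp add: divide_le_eq)
        then show ?case by (simp add: d_def algebra_simps)
      qed
    qed
    then show ?thesis
      by (intro eventually_conj eventually_gt_at_top eventually_ball_finite) auto
  qed
  have ev: "\<forall>\<^sub>F n in sequentially. \<exists>c. code_measurable n c \<and> power_ok h1 h2 h3 P n R c \<and> perr h1 h2 h3 n R c \<le> \<eta> (NN n)"
    using filterlim_iff[THEN iffD1, OF NN_lim, rule_format, OF large]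
  proof eventually_elim
    case (elim n)
    define N where "N = NN n"
    have N: "0 < N" using elim by (simp add: N_def)
    have NB: "real ((N + 1) * (B + 1)) * r j \<le> real (N * B) * \<rho> j" if "j \<in> {1,2,3}" for j
      using elim that by (auto simp: N_def)
    have nN: "(B + 1) * N \<le> n" unfolding N_def NN_def by (rule times_div_less_eq_dividend)
    have nN': "n \<le> (N + 1) * (B + 1)"
      using dividend_less_div_times[of "B + 1" n] by (simp add: N_def NN_def algebra_simps)
    define L where "L j = msize N (\<rho> j)" for j
    define Mz where "Mz j = msize n (r j)" for j
    have L_ge: "2 powr (real N * \<rho> j) \<le> real (L j)" for j
      by (simp add: L_def msize_def)
    have L_le: "real (L j) \<le> 2 * 2 powr (real N * \<rho> j)" if "j \<in> {1,2,3}" for j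
    proof -
      have "1 \<le> 2 powr (real N * \<rho> j)" using \<rho>0[OF that] by (simp add: ge_one_powr_ge_zero)
      then show ?thesis unfolding L_def msize_def by linarith
    qed
    have "Mz j \<le> L j ^ B" if "j \<in> {1,2,3}" for j
    proof -
      have "real n * r j \<le> real ((N + 1) * (B + 1)) * r j"
        using nN' r[OF that] by (intro mult_right_mono) (simp_all only: of_nat_le_iff)
      also have "\<dots> \<le> real (N * B) * \<rho> j" by (rule NB[OF that])
      finally have "2 powr (real n * r j) \<le> 2 powr (real (N * B) * \<rho> j)" by simp
      also have "\<dots> = (2 powr (real N * \<rho> j)) ^ B"
        by (simp add: powr_power algebra_simps)
      also have "\<dots> \<le> real (L j) ^ B" by (intro power_mono L_ge) simp
      finally show ?thesis by (simp add: Mz_def msize_def nat_ceiling_le_eq)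
    qed
    then have "\<forall>j\<in>{1,2,3}. \<exists>\<phi>. (\<forall>m b. m \<in> {1..Mz j} \<longrightarrow> b < B \<longrightarrow> \<phi> m b < L j) \<and>
       (\<forall>m m'. m \<in> {1..Mz j} \<longrightarrow> m' \<in> {1..Mz j} \<longrightarrow> (\<forall>b<B. \<phi> m b = \<phi> m' b) \<longrightarrow> m = m')"
      by (metis exists_digits)
    then obtain \<phi> where \<phi>: "\<And>j m b. j \<in> {1,2,3} \<Longrightarrow> m \<in> {1..Mz j} \<Longrightarrow> b < B \<Longrightarrow> \<phi> j m b < L j"
      "\<And>j m m'. j \<in> {1,2,3} \<Longrightarrow> m \<in> {1..Mz j} \<Longrightarrow> m' \<in> {1..Mz j} \<Longrightarrow> (\<forall>b<B. \<phi> j m b = \<phi> j m' b) \<Longrightarrow> m = m'"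
      unfolding bchoice_iff by blast
    interpret D: decode_forward h1 h2 h3 P q e \<beta> \<rho> n N B L Mz \<phi>
    proof
      show "2 powr (\<Sum>j\<in>S. \<rho> j) * exp e \<le> \<beta> * sqrt (1 + (\<Sum>j\<in>S. (?h j)\<^sup>2 * q))" if "S \<subseteq> {1,2,3}" "S \<noteq> {}" for S
      proof (rule scale)
        show "2 powr (\<Sum>j\<in>S. \<rho> j) / sqrt (1 + (\<Sum>j\<in>S. (?h j)\<^sup>2 * q)) \<le> c"
          using c1(3)[of S] c(3) that by auto
        have "0 \<le> (\<Sum>j\<in>S. (?h j)\<^sup>2 * q)" using q by (intro sum_nonneg) auto
        then show "0 < sqrt (1 + (\<Sum>j\<in>S. (?h j)\<^sup>2 * q))" by simp
      qed
      show "2 powr (\<Sum>k\<in>{1,2,3} - {j}. \<rho> k) * exp e \<le> \<beta> * sqrt (1 + (?h j)\<^sup>2 * q)" if "j \<in> {1,2}" for j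
      proof (rule scale)
        show "2 powr (\<Sum>k\<in>{1,2,3} - {j}. \<rho> k) / sqrt (1 + (?h j)\<^sup>2 * q) \<le> c"
          using c2(3)[OF that] c(4) by linarith
        show "0 < sqrt (1 + (?h j)\<^sup>2 * q)" using q by (simp add: add_pos_nonneg)
      qed
      show "0 \<le> \<beta>" using \<beta> by simp
      show "m = m'" if "j \<in> {1,2,3}" "m \<in> {1..Mz j}" "m' \<in> {1..Mz j}" "\<And>b. b < B \<Longrightarrow> \<phi> j m b = \<phi> j m' b" for j m m'
        using \<phi>(2)[OF that(1-3)] that(4) by blast
      show "\<phi> j m b < L j" if "j \<in> {1,2,3}" "m \<in> {1..Mz j}" "b < B" for j m b
        by (rule \<phi>(1)[OF that])
      show "real (L j) \<le> 2 * 2 powr (real N * \<rho> j)" if "j \<in> {1,2,3}" for j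
        by (rule L_le[OF that])
    qed (fact h q e qe N nN)+
    have valid: "D.valid_messages m" if "m \<in> msgs n R" for m
    proof -
      note mem = msgs_range[OF that]
      show ?thesis
        unfolding D.valid_messages_def Mz_def
        using mem[of 1 2] mem[of 1 3] mem[of 2 1] mem[of 2 3] mem[of 3 1] mem[of 3 2]
        by (auto simp: user_pairs_eq R_def three_rates_def oth1_def msize_0)
    qed
    obtain g where "perr h1 h2 h3 n R (D.code g) \<le> \<eta> N"
      using D.exists_codebook[OF finite_msgs msgs_nonempty B valid] unfolding \<eta>_def by blast
    then show ?case
      using D.code_measurable_code D.power_ok_code[OF finite_msgs msgs_nonempty] unfolding N_def by blast
  qed
  define good where "good n c \<longleftrightarrow> code_measurable n c \<and> power_ok h1 h2 h3 P n R c \<and> perr h1 h2 h3 n R c \<le> \<eta> (NN n)" for n c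
  define cc where "cc n = (if \<exists>c. good n c then SOME c. good n c else silent_code)" for n
  have cc_good: "good n (cc n)" if "\<exists>c. good n c" for n
    using someI_ex[OF that] that by (simp add: cc_def)
  have cc_ok: "code_measurable n (cc n) \<and> power_ok h1 h2 h3 P n R (cc n)" for n
  proof (cases "\<exists>c. good n c")
    case True
    then show ?thesis using cc_good[OF True] by (simp add: good_def)
  next
    case False
    then show ?thesis using silent_code_measurable silent_code_power by (simp add: cc_def)
  qed
  have lim: "(\<lambda>n. perr h1 h2 h3 n R (cc n)) \<longlonglongrightarrow> 0"
  proof (rule tendsto_sandwich[of "\<lambda>_. 0"])
    show "\<forall>\<^sub>F n in sequentially. 0 \<le> perr h1 h2 h3 n R (cc n)"
      by (intro always_eventually allI) (simp add: perr_def sum_nonneg)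
    show "\<forall>\<^sub>F n in sequentially. perr h1 h2 h3 n R (cc n) \<le> \<eta> (NN n)"
      using ev
    proof eventually_elim
      case (elim n)
      then have "\<exists>c. good n c" by (simp add: good_def)
      from cc_good[OF this] show ?case by (simp add: good_def)
    qed
    show "(\<lambda>n. \<eta> (NN n)) \<longlonglongrightarrow> 0"
      by (rule filterlim_compose[OF \<eta>_lim NN_lim])
  qed simp
  have "\<forall>(j, k)\<in>user_pairs. 0 \<le> R j k"
    using r[of 1] r[of 2] r[of 3] by (simp add: R_def three_rates_def user_pairs_eq oth1_def)
  then show ?thesis
    unfolding achievable_def R_def[symmetric] using cc_ok lim by blast
qed

section \<open>Choosing rates up to the capacity constraints\<close>

lemma Cf_mono: "0 \<le> x \<Longrightarrow> x \<le> y \<Longrightarrow> Cf x \<le> Cf y"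
  by (simp add: Cf_def)

lemma Cf_pos: "0 < x \<Longrightarrow> 0 < Cf x"
  by (simp add: Cf_def)

lemma Cf_tendsto:
  assumes "0 \<le> k" "0 < P"
  shows "((\<lambda>q. Cf (k * q)) \<longlongrightarrow> Cf (k * P)) (at_left P)"
proof -
  have "1 + k * P > 0" using assms by (simp add: add_pos_nonneg)
  then show ?thesis
    unfolding Cf_def by (intro tendsto_intros) auto
qed

lemma nonempty_subsets_123:
  assumes "S \<subseteq> {1,2,3::nat}" "S \<noteq> {}"
  shows "S \<in> {{1},{2},{3},{1,2},{1,3},{2,3},{1,2,3}}"
proof -
  define p where "p x = (if x \<in> S then {x} else {})" for x
  have "S = p 1 \<union> (p 2 \<union> p 3)"
    using assms(1) unfolding p_def by (auto split: if_splits)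
  moreover have "p x = {} \<or> p x = {x}" for x
    by (simp add: p_def)
  then have "p 1 = {} \<or> p 1 = {1}" "p 2 = {} \<or> p 2 = {2}" "p 3 = {} \<or> p 3 = {3}"
    by blast+
  ultimately show ?thesis
    using assms(2) by (elim disjE) (simp_all add: insert_commute)
qed

text \<open>Every constraint has a right side of at least \<open>C3 > 0\<close>, so scaling the
  rates by \<open>1 - \<eta>\<close> frees at least \<open>\<eta> * C3\<close>. Raising up to three
  digit rates by a quarter of that keeps all constraints strict, and continuity of \<open>Cf\<close>
  keeps them strict for some power \<open>q < P\<close>.\<close>

lemma scaled_sum_achievable:
  fixes h1 h2 h3 P :: real and r :: "nat \<Rightarrow> real"
  assumes h: "h1 \<noteq> 0" "h2 \<noteq> 0" "h3 \<noteq> 0" and h_ord: "h1\<^sup>2 \<ge> h2\<^sup>2" "h2\<^sup>2 \<ge> h3\<^sup>2" and P: "0 < P" and \<eta>: "0 < \<eta>" "\<eta> < 1"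
    and r: "\<And>j. j \<in> {1,2,3} \<Longrightarrow> 0 \<le> r j"
    and up: "\<And>S. S \<subseteq> {1,2,3} \<Longrightarrow> S \<noteq> {} \<Longrightarrow> (\<Sum>j\<in>S. r j) \<le> Cf ((\<Sum>j\<in>S. (gain h1 h2 h3 j)\<^sup>2) * P)"
    and down: "\<And>j. j \<in> {1,2} \<Longrightarrow> (\<Sum>k\<in>{1,2,3} - {j}. r k) \<le> Cf ((gain h1 h2 h3 j)\<^sup>2 * P)"
  shows "achievable h1 h2 h3 P (three_rates (\<lambda>j. (1 - \<eta>) * r j))"
proof -
  let ?h = "gain h1 h2 h3"
  define C3 where "C3 = Cf (h3\<^sup>2 * P)"
  have C3: "0 < C3" using h P by (simp add: C3_def Cf_pos)
  define \<tau> where "\<tau> = \<eta> * C3 / 4"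
  have \<tau>: "0 < \<tau>" using \<eta> C3 by (simp add: \<tau>_def)
  define \<rho> where "\<rho> j = (1 - \<eta>) * r j + \<tau>" for j
  have h3_le: "h3\<^sup>2 \<le> (?h j)\<^sup>2" for j
    using h_ord by (auto simp: gain_def)
  have slack: "(\<Sum>j\<in>S. \<rho> j) < C" if S: "S \<subseteq> {1,2,3}" and C: "(\<Sum>j\<in>S. r j) \<le> C" "C3 \<le> C" for S C
  proof -
    have "card S \<le> 3" using card_mono[OF _ S] by simp
    then have "real (card S) * \<tau> \<le> 3 * \<tau>" using \<tau> by (intro mult_right_mono) auto
    also have "\<dots> < \<eta> * C3" using \<eta> C3 by (simp add: \<tau>_def)
    also have "\<dots> \<le> \<eta> * C" using \<eta> C by (intro mult_left_mono) auto
    finally have a: "real (card S) * \<tau> < \<eta> * C" .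
    have b: "(1 - \<eta>) * (\<Sum>j\<in>S. r j) \<le> (1 - \<eta>) * C" using \<eta> C by (intro mult_left_mono) auto
    have "(\<Sum>j\<in>S. \<rho> j) = (1 - \<eta>) * (\<Sum>j\<in>S. r j) + real (card S) * \<tau>"
      by (simp add: \<rho>_def sum.distrib sum_distrib_left)
    also have "\<dots> < (1 - \<eta>) * C + \<eta> * C" using a b by linarith
    finally show ?thesis by (simp add: algebra_simps)
  qed
  have up': "\<forall>\<^sub>F q in at_left P. (\<Sum>j\<in>S. \<rho> j) < Cf ((\<Sum>j\<in>S. (?h j)\<^sup>2) * q)" if S: "S \<subseteq> {1,2,3}" "S \<noteq> {}" for S
  proof (rule order_tendstoD(1)[OF Cf_tendsto])
    show "0 \<le> (\<Sum>j\<in>S. (?h j)\<^sup>2)" by (intro sum_nonneg) auto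
    obtain j where j: "j \<in> S" using S by blast
    have "h3\<^sup>2 \<le> (?h j)\<^sup>2" by (rule h3_le)
    also have "\<dots> \<le> (\<Sum>j\<in>S. (?h j)\<^sup>2)"
      using j S finite_subset[OF S(1)] by (intro member_le_sum) auto
    finally have "C3 \<le> Cf ((\<Sum>j\<in>S. (?h j)\<^sup>2) * P)"
      unfolding C3_def using P by (intro Cf_mono mult_right_mono) auto
    then show "(\<Sum>j\<in>S. \<rho> j) < Cf ((\<Sum>j\<in>S. (?h j)\<^sup>2) * P)"
      by (intro slack S up)
  qed (rule P)
  have down': "\<forall>\<^sub>F q in at_left P. (\<Sum>k\<in>{1,2,3} - {j}. \<rho> k) < Cf ((?h j)\<^sup>2 * q)" if j: "j \<in> {1,2}" for j
  proof (rule order_tendstoD(1)[OF Cf_tendsto])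
    have "C3 \<le> Cf ((?h j)\<^sup>2 * P)"
      unfolding C3_def using P h3_le by (intro Cf_mono mult_right_mono) auto
    then show "(\<Sum>k\<in>{1,2,3} - {j}. \<rho> k) < Cf ((?h j)\<^sup>2 * P)"
      by (intro slack down j) auto
  qed (use P in auto)
  have "\<forall>\<^sub>F q in at_left P. (\<forall>S\<in>Pow {1,2,3} - {{}}. (\<Sum>j\<in>S. \<rho> j) < Cf ((\<Sum>j\<in>S. (?h j)\<^sup>2) * q))
    \<and> (\<forall>j\<in>{1,2}. (\<Sum>k\<in>{1,2,3} - {j}. \<rho> k) < Cf ((?h j)\<^sup>2 * q)) \<and> q \<in> {0<..<P}"
    using up' down' eventually_at_left_real[OF P]
    by (intro eventually_conj eventually_ball_finite ballI) auto
  then obtain q where q: "\<And>S. S \<in> Pow {1,2,3} - {{}} \<Longrightarrow> (\<Sum>j\<in>S. \<rho> j) < Cf ((\<Sum>j\<in>S. (?h j)\<^sup>2) * q)"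
    "\<And>j. j \<in> {1,2} \<Longrightarrow> (\<Sum>k\<in>{1,2,3} - {j}. \<rho> k) < Cf ((?h j)\<^sup>2 * q)" "0 < q" "q < P"
    using eventually_happens'[OF trivial_limit_at_left_real] by (metis (no_types, lifting) greaterThanLessThan_iff)
  \<comment> \<open>The delay costs one extra copy of each rate, and the \<open>B\<close> surpluses
    \<open>\<tau>\<close> have to outweigh it.\<close>
  obtain B :: nat where B: "((1 - \<eta>) * (r 1 + r 2 + r 3)) / \<tau> < real B"
    using reals_Archimedean2 by blast
  then have B': "(1 - \<eta>) * (r 1 + r 2 + r 3) < real B * \<tau>"
    using \<tau> by (simp add: divide_less_eq)
  show ?thesis
  proof (rule decode_forward_achievable[where q=q and B=B and \<rho>=\<rho>])
    have "0 \<le> (1 - \<eta>) * (r 1 + r 2 + r 3)" using \<eta> r by auto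
    then have "0 < real B * \<tau>" using B' by linarith
    then show "0 < B" using \<tau> by (simp add: zero_less_mult_iff)
    show "real (B + 1) * ((1 - \<eta>) * r j) < real B * \<rho> j" if "j \<in> {1,2,3}" for j
    proof -
      have "r j \<le> r 1 + r 2 + r 3" using r[of 1] r[of 2] r[of 3] that by auto
      then have "(1 - \<eta>) * r j \<le> (1 - \<eta>) * (r 1 + r 2 + r 3)" using \<eta> by (intro mult_left_mono) auto
      then have "(1 - \<eta>) * r j < real B * \<tau>" using B' by linarith
      then show ?thesis by (simp add: \<rho>_def algebra_simps)
    qed
    show "0 \<le> (1 - \<eta>) * r j" if "j \<in> {1,2,3}" for j using \<eta> r[OF that] by simp
    show "(\<Sum>j\<in>S. \<rho> j) < Cf (\<Sum>j\<in>S. (?h j)\<^sup>2 * q)" if "S \<subseteq> {1,2,3}" "S \<noteq> {}" for S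
      using q(1)[of S] that by (simp add: sum_distrib_right)
  qed (use h q in auto)
qed

theorem theorem3:
  fixes h1 h2 h3 P :: real
  assumes "h1\<^sup>2 \<ge> h2\<^sup>2" and "h2\<^sup>2 \<ge> h3\<^sup>2" and "P > 0"
  shows "ereal (min (min
            (1/2 * (Cf (min (h1\<^sup>2) (h2\<^sup>2 + h3\<^sup>2) * P) + Cf (h2\<^sup>2 * P) + Cf (h3\<^sup>2 * P)))
            (Cf ((h1\<^sup>2 + h2\<^sup>2 + h3\<^sup>2) * P)))
            (2 * Cf (h3\<^sup>2 * P)))
         \<le> sum_capacity h1 h2 h3 P"
proof -
  define C2 C3 C23 Cs where "C2 = Cf (h2\<^sup>2 * P)" and "C3 = Cf (h3\<^sup>2 * P)"
    and "C23 = Cf (min (h1\<^sup>2) (h2\<^sup>2 + h3\<^sup>2) * P)" and "Cs = Cf ((h1\<^sup>2 + h2\<^sup>2 + h3\<^sup>2) * P)"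
  define T where "T = min (min (1/2 * (C23 + C2 + C3)) Cs) (2 * C3)"
  have "ereal T \<le> sum_capacity h1 h2 h3 P"
  proof (cases "h3 = 0")
    case True
    \<comment> \<open>If \<open>h3\<close> vanishes, the term \<open>2 * C3\<close> is 0, and rate
      zero suffices.\<close>
    then have "T \<le> 0" by (simp add: T_def C3_def Cf_def)
    then have "ereal T \<le> ereal (\<Sum>(j, k)\<in>user_pairs. (\<lambda>_ _. 0) j k)" by simp
    also have "\<dots> \<le> sum_capacity h1 h2 h3 P"
      unfolding sum_capacity_def using achievable_zero by (intro SUP_upper) simp
    finally show ?thesis .
  next
    case False
    then have h3: "0 < h3\<^sup>2" by simp
    then have h2: "0 < h2\<^sup>2" and h1: "0 < h1\<^sup>2" using assms by linarith+
    have mono: "Cf (x * P) \<le> Cf (y * P)" if "0 \<le> x" "x \<le> y" for x y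
      using that assms by (intro Cf_mono mult_right_mono) auto
    have C3: "0 < C3" unfolding C3_def using h3 assms by (intro Cf_pos) simp
    have C32: "C3 \<le> C2" and C323: "C3 \<le> C23" and C3s: "C3 \<le> Cs"
      unfolding C2_def C3_def C23_def Cs_def using assms h1 h2 h3 by (auto intro!: mono)
    \<comment> \<open>A greedy choice: \<open>r3\<close> takes only what exceeds \<open>C3\<close>,
      which gives \<open>r1 + r2 \<le> C3\<close>; \<open>r1\<close> is as large as
      \<open>r1 + r3 \<le> C2\<close> permits; \<open>r2\<close> takes the rest.\<close>
    define r3 r1 where "r3 = max 0 (T - C3)" and "r1 = min (T - r3) (C2 - r3)"
    define r2 where "r2 = T - r3 - r1"
    define r where "r = (\<lambda>j::nat. if j = 1 then r1 else if j = 2 then r2 else r3)"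
    have T: "0 < T" "T \<le> 2 * C3" "T \<le> Cs" "2 * T \<le> C23 + C2 + C3"
    proof -
      show "0 < T" using C3 C32 C323 C3s by (auto simp: T_def)
      show "T \<le> 2 * C3" "T \<le> Cs" by (simp_all add: T_def)
      have "T \<le> 1/2 * (C23 + C2 + C3)" unfolding T_def by (rule min.coboundedI1, rule min.cobounded1)
      then show "2 * T \<le> C23 + C2 + C3" by simp
    qed
    have bounds: "0 \<le> r1" "0 \<le> r2" "0 \<le> r3" "r1 \<le> C2" "r2 \<le> C2" "r3 \<le> C3" "r1 + r2 \<le> C3" "r1 + r3 \<le> C2"
      "r2 + r3 \<le> C23" "r1 + r2 + r3 = T"
    proof -
      \<comment> \<open>In the third regime \<open>r2 + r3 = 2 * T - C2 - C3\<close>, so the half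
        sum in \<open>T\<close> is what yields \<open>r2 + r3 \<le> C23\<close>. The term
        \<open>2 * C3\<close> yields \<open>r3 \<le> C3\<close> and
        \<open>0 \<le> r1\<close>.\<close>
      consider "T \<le> C3" "r3 = 0" "r1 = T" "r2 = 0"
        | "C3 \<le> T" "T \<le> C2" "r3 = T - C3" "r1 = C3" "r2 = 0"
        | "C3 \<le> T" "C2 \<le> T" "r3 = T - C3" "r1 = C2 + C3 - T" "r2 = T - C2"
      proof (cases "T \<le> C3")
        case True
        then show ?thesis using C32 by (intro that(1)) (simp_all add: r2_def r1_def r3_def)
      next
        case c: False
        show ?thesis
        proof (cases "T \<le> C2")
          case True
          then show ?thesis using c by (intro that(2)) (simp_all add: r2_def r1_def r3_def)
        next
          case False
          then show ?thesis using c by (intro that(3)) (simp_all add: r2_def r1_def r3_def)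
        qed
      qed
      then show "0 \<le> r1" "0 \<le> r2" "0 \<le> r3" "r1 \<le> C2" "r2 \<le> C2" "r3 \<le> C3" "r1 + r2 \<le> C3" "r1 + r3 \<le> C2"
        "r2 + r3 \<le> C23" "r1 + r2 + r3 = T"
        by (cases; use T C3 C32 C323 in linarith)+
    qed
    \<comment> \<open>The minimum inside \<open>C23\<close> makes it serve twice: for the downlink
      to user 1 and for the joint uplink of users 2 and 3.\<close>
    have caps: "C2 \<le> Cf (h1\<^sup>2 * P)" "C23 \<le> Cf (h1\<^sup>2 * P)" "C3 \<le> Cf ((h1\<^sup>2 + h2\<^sup>2) * P)" "C2 \<le> Cf ((h1\<^sup>2 + h3\<^sup>2) * P)"
      "C23 \<le> Cf ((h2\<^sup>2 + h3\<^sup>2) * P)"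
      unfolding C2_def C3_def C23_def by (rule mono; use assms h1 h2 h3 in linarith)+
    have singles: "r1 \<le> Cf (h1\<^sup>2 * P)" "r2 \<le> Cf (h2\<^sup>2 * P)" "r3 \<le> Cf (h3\<^sup>2 * P)"
      using bounds caps unfolding C2_def C3_def by linarith+
    have pairs: "r1 + r2 \<le> Cf ((h1\<^sup>2 + h2\<^sup>2) * P)" "r1 + r3 \<le> Cf ((h1\<^sup>2 + h3\<^sup>2) * P)" "r2 + r3 \<le> Cf ((h2\<^sup>2 + h3\<^sup>2) * P)"
      using bounds caps by linarith+
    have triple: "r1 + (r2 + r3) \<le> Cf ((h1\<^sup>2 + (h2\<^sup>2 + h3\<^sup>2)) * P)"
      using bounds(10) T(3) unfolding Cs_def by (simp add: add.assoc)
    have up: "(\<Sum>j\<in>S. r j) \<le> Cf ((\<Sum>j\<in>S. (gain h1 h2 h3 j)\<^sup>2) * P)" if S: "S \<subseteq> {1,2,3}" "S \<noteq> {}" for S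
    proof -
      have "S = {1} \<or> S = {2} \<or> S = {3} \<or> S = {1,2} \<or> S = {1,3} \<or> S = {2,3} \<or> S = {1,2,3}"
        using nonempty_subsets_123[OF S] by simp
      then show ?thesis
        by (elim disjE) (use singles pairs triple in \<open>simp_all add: r_def gain_def\<close>)
    qed
    have d1: "{1,2,3} - {1} = {2,3::nat}" and d2: "{1,2,3} - {2} = {1,3::nat}" by auto
    have down: "(\<Sum>k\<in>{1,2,3} - {j}. r k) \<le> Cf ((gain h1 h2 h3 j)\<^sup>2 * P)" if j: "j \<in> {1,2}" for j
    proof (cases "j = 1")
      case True
      have "r2 + r3 \<le> Cf (h1\<^sup>2 * P)" using bounds caps by linarith
      then show ?thesis unfolding True d1 by (simp add: r_def gain_def)
    next
      case False
      then have j2: "j = 2" using j by simp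
      have "r1 + r3 \<le> Cf (h2\<^sup>2 * P)" using bounds unfolding C2_def by linarith
      then show ?thesis unfolding j2 d2 by (simp add: r_def gain_def)
    qed
    have step: "ereal ((1 - \<eta>) * T) \<le> sum_capacity h1 h2 h3 P" if \<eta>: "0 < \<eta>" "\<eta> < 1" for \<eta>
    proof -
      have "achievable h1 h2 h3 P (three_rates (\<lambda>j. (1 - \<eta>) * r j))"
      proof (rule scaled_sum_achievable)
        show "0 \<le> r j" for j using bounds(1-3) by (simp add: r_def)
        show "h1 \<noteq> 0" "h2 \<noteq> 0" "h3 \<noteq> 0" using h1 h2 h3 by auto
      qed (use assms \<eta> up down in blast)+
      then have "ereal (\<Sum>(j, k)\<in>user_pairs. three_rates (\<lambda>j. (1 - \<eta>) * r j) j k) \<le> sum_capacity h1 h2 h3 P"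
        unfolding sum_capacity_def by (intro SUP_upper) simp
      moreover have "(\<Sum>(j, k)\<in>user_pairs. three_rates (\<lambda>j. (1 - \<eta>) * r j) j k) = (1 - \<eta>) * T"
        unfolding sum_three_rates by (simp add: r_def bounds(10)[symmetric] algebra_simps)
      ultimately show ?thesis by simp
    qed
    \<comment> \<open>The shift by 2 keeps the loss strictly between 0 and 1 for every
      \<open>k\<close>.\<close>
    have "(\<lambda>k. (1 - 1 / real (k + 2)) * T) \<longlonglongrightarrow> (1 - 0) * T"
      by (intro tendsto_mult tendsto_diff tendsto_const LIMSEQ_ignore_initial_segment[OF lim_1_over_n])
    then have "(\<lambda>k. ereal ((1 - 1 / real (k + 2)) * T)) \<longlonglongrightarrow> ereal T"
      by simp
    then show ?thesis
      by (rule LIMSEQ_le_const2) (auto intro!: step exI[of _ 0])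
  qed
  then show ?thesis
    by (simp only: T_def C2_def C3_def C23_def Cs_def)
qed

end
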